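(* Let $d\geq 2$ and $1\leq i,j\leq d-1$, and let $P_1$ and $P_2$ be $d$-polytopes such that $P_1$ has a simplex facet $F$ and $P_2$ has a simple vertex $v$, and let $P_1\triangleright P_2$ be a merge of $P_1$ and $P_2$ along $F$ and $v$ (for any ordering of the vertices of $F$ and of the neighbors of $v$). If $P_1$ and $P_2$ are both $j$-simplicial, then so is $P_1\triangleright P_2$. If $P_1$ and $P_2$ are both $i$-simple, then so is $P_1\triangleright P_2$.
   Context: A $d$-polytope is $j$-simplicial if all its $j$-faces are simplices, and $i$-simple if every $(d-i-1)$-face is contained in exactly $i+1$ facets. A vertex of a $d$-polytope is simple if it lies in exactly $d$ facets (so it has exactly $d$ neighbors). Merge: let $P_1$ have a simplex facet $F=\mathrm{conv}(u_1,\dots,u_d)$ (vertices listed in this order) and let $P_2$ have a simple vertex $v$ whose neighbors are listed in the order $u'_1,\dots,u'_d$. For $1\leq j\leq d$ let $H_j$ be the facet of $P_1$ meeting $F$ in the ridge $\mathrm{conv}(u_k: k\neq j)$. After applying a projective transformation to $P_1$, one may assume the hyperplanes $\mathrm{aff}(F),\mathrm{aff}(H_1),\dots,\mathrm{aff}(H_d)$ bound a $d$-simplex $\Sigma$ containing $P_1$; let $u$ be the vertex of $\Sigma$ not in $F$. After applying to $P_2$ the affine map sending $v\mapsto u$ and $u'_k\mapsto u_k$ for all $k$, one has $P_1\subseteq \Sigma=\mathrm{conv}(v,u'_1,\dots,u'_d)\subseteq P_2$. Let $P_2'=\mathrm{conv}(V(P_2)\setminus\{v\})$. The merge $P_1\triangleright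 P_2$ of $P_1$ and $P_2$ along $F$ and $v$ is the $d$-polytope $P_1\cup P_2'$ (equivalently, $P_2$ with $\Sigma$ replaced by $P_1$), where $u_k$ is identified with $u'_k$. Its combinatorial type may depend on the chosen orderings. *)

theory Defs
  imports "HOL-Analysis.Analysis"
begin

definition d_polytope :: "nat \<Rightarrow> 'a::euclidean_space set \<Rightarrow> bool" where
  "d_polytope d P \<longleftrightarrow> polytope P \<and> aff_dim P = int d"

definition j_simplicial :: "nat \<Rightarrow> nat \<Rightarrow> 'a::euclidean_space set \<Rightarrow> bool" where
  "j_simplicial d j P \<longleftrightarrow> d_polytope d P \<and>
     (\<forall>G. G face_of P \<and> aff_dim G = int j \<longrightarrow> int j simplex G)"

definition i_simple :: "nat \<Rightarrow> nat \<Rightarrow> 'a::euclidean_space set \<Rightarrow> bool" where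
  "i_simple d i P \<longleftrightarrow> d_polytope d P \<and>
     (\<forall>G. G face_of P \<and> aff_dim G = int d - int i - 1 \<longrightarrow>
        card {H. H facet_of P \<and> G \<subseteq> H} = i + 1)"

definition vertices :: "'a::euclidean_space set \<Rightarrow> 'a set" where
  "vertices P = {x. x extreme_point_of P}"

definition neighbours :: "'a::euclidean_space set \<Rightarrow> 'a \<Rightarrow> 'a set" where
  "neighbours P v = {w \<in> vertices P. closed_segment v w edge_of P}"

definition simplex_facet :: "nat \<Rightarrow> 'a::euclidean_space set \<Rightarrow> 'a set \<Rightarrow> bool" where
  "simplex_facet d P F \<longleftrightarrow> F facet_of P \<and> (int d - 1) simplex F"

definition simple_vertex :: "nat \<Rightarrow> 'a::euclidean_space set \<Rightarrow> 'a \<Rightarrow> bool" where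
  "simple_vertex d P v \<longleftrightarrow> v \<in> vertices P \<and> card {G. G facet_of P \<and> v \<in> G} = d"

text \<open>A projective transformation is an invertible linear map \<open>T\<close> in homogeneous coordinates;
  it is admissible for \<open>S\<close> if no point of \<open>S\<close> is sent to infinity. The values of \<open>f\<close>
  outside \<open>S\<close> are irrelevant.\<close>

definition projective_on :: "'a::euclidean_space set \<Rightarrow> ('a \<Rightarrow> 'a) \<Rightarrow> bool" where
  "projective_on S f \<longleftrightarrow>
     (\<exists>T :: 'a \<times> real \<Rightarrow> 'a \<times> real. linear T \<and> bij T \<and>
        (\<forall>x\<in>S. snd (T (x, 1)) \<noteq> 0 \<and> f x = fst (T (x, 1)) /\<^sub>R snd (T (x, 1))))"

definition affine_map :: "('a::euclidean_space \<Rightarrow> 'a) \<Rightarrow> bool" where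
  "affine_map g \<longleftrightarrow> (\<exists>A b. linear A \<and> g = (\<lambda>x. A x + b))"

text \<open>\<open>is_merge d P1 F u P2 v u' M\<close>: the set \<open>M\<close> is a merge of \<open>P1\<close> and \<open>P2\<close> along the simplex
  facet \<open>F\<close>, with vertices listed as \<open>u 1, \<dots>, u d\<close>, and the simple vertex \<open>v\<close>, with neighbours
  listed as \<open>u' 1, \<dots>, u' d\<close>. It is a relation because \<open>M\<close> depends on the projective
  transformation \<open>f\<close>. The point \<open>a\<close> is the vertex of \<open>\<Sigma>\<close> outside the image of \<open>F\<close>.\<close>

definition is_merge ::
  "nat \<Rightarrow> 'a::euclidean_space set \<Rightarrow> 'a set \<Rightarrow> (nat \<Rightarrow> 'a) \<Rightarrow>
   'a set \<Rightarrow> 'a \<Rightarrow> (nat \<Rightarrow> 'a) \<Rightarrow> 'a set \<Rightarrow> bool" where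
  "is_merge d P1 F u P2 v u' M \<longleftrightarrow>
     (\<exists>H f \<Sigma> a g.
        (\<forall>j\<in>{1..d}. H j facet_of P1 \<and> H j \<inter> F = convex hull (u ` ({1..d} - {j}))) \<and>
        projective_on P1 f \<and>
        int d simplex \<Sigma> \<and>
        {affine hull G |G. G facet_of \<Sigma>} =
          insert (affine hull (f ` F)) ((\<lambda>j. affine hull (f ` H j)) ` {1..d}) \<and>
        f ` P1 \<subseteq> \<Sigma> \<and>
        a \<in> vertices \<Sigma> \<and> a \<notin> f ` F \<and>
        affine_map g \<and> g v = a \<and> (\<forall>k\<in>{1..d}. g (u' k) = f (u k)) \<and>
        M = f ` P1 \<union> convex hull (vertices (g ` P2) - {g v}))"

end

theory Submission
  imports Defs
begin

text \<open>
  Write \<open>Q1\<close>, \<open>Q2\<close> for the transformed polytopes and \<open>h\<close> for the barycentric coordinate of the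
  vertex \<open>a\<close> of \<open>\<Sigma>\<close>. Since \<open>a\<close> is the only vertex of \<open>Q2\<close> with \<open>h > 0\<close>, the merge \<open>M\<close> agrees
  with \<open>Q1\<close> on \<open>h \<ge> 0\<close> and with \<open>Q2\<close> on \<open>h \<le> 0\<close>. The dimension of a face and the number of
  facets through it are local, so a face of \<open>M\<close> that leaves \<open>h = 0\<close> inherits them from \<open>Q1\<close> or
  \<open>Q2\<close>. If a face of \<open>M\<close> meets \<open>h < 0\<close>, the corresponding face of \<open>Q2\<close> cannot be a simplex
  through \<open>a\<close>, whose other vertices would all be neighbours of \<open>a\<close>; so it avoids \<open>a\<close> and is the
  given face. Finally let \<open>K\<close> be a face of \<open>M\<close> in \<open>h = 0\<close>, hence a face of the common simplex
  facet. Simplicity of \<open>Q1\<close> says that the facets of \<open>Q1\<close> through \<open>K\<close> lie in facets of \<open>\<Sigma>\<close>;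
  this forces \<open>K\<close> to be a face of \<open>Q2\<close>, and the facets of \<open>M\<close> and of \<open>Q2\<close> through
  \<open>K\<close> span the same hyperplanes.
\<close>

section \<open>Polytopes that agree on an open set\<close>

lemma open_small_step:
  fixes x :: "'a::real_normed_vector"
  assumes "open U" "x \<in> U" "d > 0"
  obtains e where "0 < e" "e \<le> d" "x + e *\<^sub>R (y - x) \<in> U"
proof -
  obtain r where r: "r > 0" "ball x r \<subseteq> U"
    using assms(1,2) open_contains_ball by blast
  define e where "e = min d (r / (2 * (norm (y - x) + 1)))"
  have n: "norm (y - x) + 1 > 0"
    by (smt (verit) norm_ge_zero)
  have "e > 0"
    using assms(3) r n by (simp add: e_def)
  moreover have "e \<le> d" by (simp add: e_def)
  moreover have "e * norm (y - x) < r"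
  proof -
    have "e * (norm (y - x) + 1) \<le> r / (2 * (norm (y - x) + 1)) * (norm (y - x) + 1)"
      using n by (intro mult_right_mono) (auto simp: e_def)
    also have "\<dots> = r / 2" using n by (simp add: field_simps)
    finally show ?thesis using r \<open>e > 0\<close> by (simp add: distrib_left)
  qed
  then have "x + e *\<^sub>R (y - x) \<in> U"
    using r \<open>e > 0\<close> by (intro subsetD[OF r(2)]) (simp add: dist_norm)
  ultimately show ?thesis using that by blast
qed

lemma step_in_convex:
  assumes "convex S" "x \<in> S" "y \<in> S" "0 \<le> e" "e \<le> 1"
  shows "x + e *\<^sub>R (y - x) \<in> S"
  using convexD_alt[OF assms] by (simp add: algebra_simps)

text \<open>A functional supporting \<open>S\<close> in \<open>K\<close> also supports
  \<open>T\<close>: a point of \<open>T\<close> violating the inequality could be pulled towards a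
  point of \<open>K\<close> in \<open>U\<close> until it lies in \<open>U\<close>, hence in
  \<open>S\<close>. The affine hulls agree because a convex set that meets an open set has the same
  affine hull as its part in that open set.\<close>

lemma local_face:
  fixes S T :: "'a::euclidean_space set"
  assumes "polytope S" "convex T" "open U" "S \<inter> U = T \<inter> U" "K face_of S" "K \<inter> U \<noteq> {}"
  shows "(T \<inter> affine hull K) face_of T" "affine hull (T \<inter> affine hull K) = affine hull K"
proof -
  obtain a b where ab: "S \<subseteq> {x. a \<bullet> x \<le> b}" "K = S \<inter> {x. a \<bullet> x = b}"
    using assms(1,5) exposed_face_of_polyhedron[of S K]
    by (auto simp: polytope_imp_polyhedron exposed_face_of_def)
  obtain x where x: "x \<in> K" "x \<in> U" using assms(6) by blast
  have xT: "x \<in> T" "a \<bullet> x = b" using x ab assms(4) by auto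
  have T: "a \<bullet> y \<le> b" if "y \<in> T" for y
  proof (rule ccontr)
    assume c: "\<not> a \<bullet> y \<le> b"
    obtain e where e: "0 < e" "e \<le> 1" "x + e *\<^sub>R (y - x) \<in> U"
      using open_small_step[OF assms(3) x(2), of 1 y] by auto
    then have "x + e *\<^sub>R (y - x) \<in> S"
      using step_in_convex[OF assms(2) xT(1) that, of e] assms(4) by auto
    then have "a \<bullet> (x + e *\<^sub>R (y - x)) \<le> b" using ab by blast
    then have "e * (a \<bullet> y - b) \<le> 0" using xT by (simp add: inner_add inner_diff)
    then show False using c e by (simp add: mult_le_0_iff)
  qed
  define L where "L = T \<inter> {x. a \<bullet> x = b}"
  have L: "L face_of T"
    unfolding L_def using face_of_Int_supporting_hyperplane_le[OF assms(2), of a b] T by blast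
  have "L \<inter> U = K \<inter> U" using assms(4) ab by (auto simp: L_def)
  moreover have "affine hull (L \<inter> U) = affine hull L"
    using affine_hull_convex_Int_open[of L U] L assms(3) x xT
    by (auto simp: face_of_imp_convex L_def)
  moreover have "affine hull (K \<inter> U) = affine hull K"
    using affine_hull_convex_Int_open[of K U] assms by (auto simp: face_of_imp_convex)
  ultimately have aff: "affine hull L = affine hull K" by simp
  have "L = T \<inter> affine hull K"
    using face_of_imp_eq_affine_Int[OF assms(2) L] aff by auto
  then show "(T \<inter> affine hull K) face_of T" "affine hull (T \<inter> affine hull K) = affine hull K"
    using L aff by auto
qed

lemma face_eq_Int_affine_hull:
  fixes S :: "'a::euclidean_space set"
  assumes "convex S" "K face_of S"
  shows "S \<inter> affine hull K = K"
  using face_of_imp_eq_affine_Int[OF assms] by auto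

lemma local_facet:
  fixes S T :: "'a::euclidean_space set"
  assumes "polytope S" "convex T" "open U" "S \<inter> U = T \<inter> U" "G facet_of S" "G \<inter> U \<noteq> {}"
  shows "(T \<inter> affine hull G) facet_of T"
proof -
  have G: "G face_of S" "aff_dim G = aff_dim S - 1" "G \<subseteq> S"
    using assms(5) by (auto simp: facet_of_def face_of_imp_subset)
  have "affine hull S = affine hull (S \<inter> U)" "affine hull T = affine hull (T \<inter> U)"
    using affine_hull_convex_Int_open[of S U] affine_hull_convex_Int_open[of T U] assms G
    by (auto simp: polytope_imp_convex)
  then have "aff_dim S = aff_dim T"
    by (metis aff_dim_affine_hull assms(4))
  moreover have "aff_dim (T \<inter> affine hull G) = aff_dim G"
    using local_face(2)[OF assms(1-4) G(1) assms(6)] by (metis aff_dim_affine_hull)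
  moreover have "T \<inter> affine hull G \<noteq> {}"
    using assms(4,6) G(3) hull_subset[of G affine] by blast
  ultimately show ?thesis
    using local_face(1)[OF assms(1-4) G(1) assms(6)] G by (simp add: facet_of_def)
qed

text \<open>A facet corresponds to the facet of the other polytope with the same affine hull. The
  two maps are mutually inverse because a face is the intersection of its polytope with the affine
  hull of the face.\<close>

lemma local_facet_card:
  fixes S T :: "'a::euclidean_space set"
  assumes S: "polytope S" and T: "polytope T" and U: "open U" and eq: "S \<inter> U = T \<inter> U"
    and K: "K face_of S" "K \<inter> U \<noteq> {}"
  shows "card {G. G facet_of S \<and> K \<subseteq> G} = card {G. G facet_of T \<and> T \<inter> affine hull K \<subseteq> G}"
proof (rule bij_betw_same_card, rule bij_betwI[where g="\<lambda>G. S \<inter> affine hull G"])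
  note cS = polytope_imp_convex[OF S] and cT = polytope_imp_convex[OF T]
  have L: "(T \<inter> affine hull K) face_of T" "affine hull (T \<inter> affine hull K) = affine hull K"
    using local_face[OF S cT U eq K] .
  have KT: "K \<inter> U \<subseteq> T \<inter> affine hull K"
    using eq face_of_imp_subset[OF K(1)] hull_subset[of K affine] by blast
  have a: "(T \<inter> affine hull G) facet_of T" "affine hull (T \<inter> affine hull G) = affine hull G"
    if "G facet_of S" "K \<subseteq> G" for G
  proof -
    have GU: "G \<inter> U \<noteq> {}" using K(2) that(2) by blast
    show "(T \<inter> affine hull G) facet_of T" "affine hull (T \<inter> affine hull G) = affine hull G"
      using local_facet[OF S cT U eq that(1) GU] local_face(2)[OF S cT U eq _ GU] that(1)
      by (simp_all add: facet_of_imp_face_of)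
  qed
  have b: "(S \<inter> affine hull G) facet_of S" "affine hull (S \<inter> affine hull G) = affine hull G"
    if "G facet_of T" "T \<inter> affine hull K \<subseteq> G" for G
  proof -
    have GU: "G \<inter> U \<noteq> {}" using K(2) KT that(2) by blast
    show "(S \<inter> affine hull G) facet_of S" "affine hull (S \<inter> affine hull G) = affine hull G"
      using local_facet[OF T cS U eq[symmetric] that(1) GU]
        local_face(2)[OF T cS U eq[symmetric] _ GU] that(1)
      by (simp_all add: facet_of_imp_face_of)
  qed
  show "(\<lambda>G. T \<inter> affine hull G) \<in> {G. G facet_of S \<and> K \<subseteq> G} \<rightarrow> {G. G facet_of T \<and> T \<inter> affine hull K \<subseteq> G}"
    using a hull_mono[of K _ affine] by blast
  show "(\<lambda>G. S \<inter> affine hull G) \<in> {G. G facet_of T \<and> T \<inter> affine hull K \<subseteq> G} \<rightarrow> {G. G facet_of S \<and> K \<subseteq> G}"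
  proof
    fix G assume G: "G \<in> {G. G facet_of T \<and> T \<inter> affine hull K \<subseteq> G}"
    then have "affine hull K \<subseteq> affine hull G"
      using L(2) hull_mono[of "T \<inter> affine hull K" G affine] by auto
    then have "K \<subseteq> S \<inter> affine hull G"
      using hull_subset[of K affine] face_of_imp_subset[OF K(1)] by blast
    then show "S \<inter> affine hull G \<in> {G. G facet_of S \<and> K \<subseteq> G}" using b G by blast
  qed
  show "S \<inter> affine hull (T \<inter> affine hull G) = G" if "G \<in> {G. G facet_of S \<and> K \<subseteq> G}" for G
    using that a(2) face_eq_Int_affine_hull[OF cS facet_of_imp_face_of] by auto
  show "T \<inter> affine hull (S \<inter> affine hull G) = G" if "G \<in> {G. G facet_of T \<and> T \<inter> affine hull K \<subseteq> G}" for G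
    using that b(2) face_eq_Int_affine_hull[OF cT facet_of_imp_face_of] by auto
qed

section \<open>Facet inequalities and feasible directions\<close>

lemma facet_hyperplane:
  fixes P :: "'a::euclidean_space set"
  assumes "interior P \<noteq> {}" "G facet_of P" "G \<subseteq> {x. a \<bullet> x = b}" "a \<noteq> 0"
  shows "affine hull G = {x. a \<bullet> x = b}"
proof -
  have "aff_dim P = DIM('a)" using assms(1) by (metis aff_dim_nonempty_interior)
  then have d: "aff_dim G = DIM('a) - 1" using assms(2) by (simp add: facet_of_def)
  have "affine hull G \<subseteq> {x. a \<bullet> x = b}"
    by (rule hull_minimal[OF assms(3)]) (simp add: affine_hyperplane)
  moreover have "aff_dim (affine hull G) = aff_dim {x. a \<bullet> x = b}"
    using d assms(4) by (simp add: aff_dim_hyperplane)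
  moreover have "affine hull G \<noteq> {}" using assms(2) by (auto simp: facet_of_def)
  ultimately show ?thesis
    by (metis affine_dim_equal affine_affine_hull affine_hyperplane)
qed

text \<open>Short steps can only violate facet inequalities that are tight at \<open>x\<close>, and
  \<open>y\<close> satisfies those: otherwise the segment from the interior point \<open>p\<close>
  to \<open>y\<close> would cross the hyperplane of such a facet, against \<open>sep\<close>. The
  others survive by continuity, and there are finitely many.\<close>

lemma feasible_direction:
  fixes P :: "'a::euclidean_space set"
  assumes P: "polytope P" "p \<in> interior P" "x \<in> P"
    and sep: "\<And>G. G facet_of P \<Longrightarrow> x \<in> G \<Longrightarrow> affine hull G \<inter> open_segment p y = {}"
  obtains e where "0 < e" "x + e *\<^sub>R (y - x) \<in> P"
proof -
  have aff: "affine hull P = UNIV"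
    using P(2) by (metis affine_hull_nonempty_interior empty_iff)
  \<comment> \<open>Minimality of this representation ensures that each of its inequalities defines
    a facet.\<close>
  obtain F where F: "finite F" "P = affine hull P \<inter> \<Inter>F"
    "\<forall>h \<in> F. \<exists>a b. a \<noteq> 0 \<and> h = {x. a \<bullet> x \<le> b}" 
    "\<forall>F'. F' \<subset> F \<longrightarrow> P \<subset> (affine hull P) \<inter> \<Inter>F'"
    using polytope_imp_polyhedron[OF P(1)] polyhedron_Int_affine_minimal[of P] by metis
  then obtain a b where ab: "\<And>h. h \<in> F \<Longrightarrow> a h \<noteq> 0 \<and> h = {x. a h \<bullet> x \<le> b h}"
    by metis
  have facet: "(P \<inter> {x. a h \<bullet> x = b h}) facet_of P" if "h \<in> F" for h
    using facet_of_polyhedron_explicit[OF F(1,2) ab] F(4) that by blast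
  have P_le: "a h \<bullet> z \<le> b h" if "h \<in> F" "z \<in> P" for h z
    using F(2) ab[OF that(1)] that by blast
  have ex: "\<forall>\<^sub>F e in at_right 0. a h \<bullet> (x + e *\<^sub>R (y - x)) \<le> b h" if h: "h \<in> F" for h
  proof (cases "a h \<bullet> x = b h")
    case False
    then have "a h \<bullet> x < b h" using P_le[OF h P(3)] by simp
    moreover have "((\<lambda>e. a h \<bullet> (x + e *\<^sub>R (y - x))) \<longlongrightarrow> a h \<bullet> (x + 0 *\<^sub>R (y - x))) (at_right 0)"
      by (intro tendsto_intros)
    ultimately have "\<forall>\<^sub>F e in at_right 0. a h \<bullet> (x + e *\<^sub>R (y - x)) < b h"
      by (intro order_tendstoD(2)) auto
    then show ?thesis by (rule eventually_mono) simp
  next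
    case True
    let ?G = "P \<inter> {x. a h \<bullet> x = b h}"
    have G: "affine hull ?G = {x. a h \<bullet> x = b h}"
      using facet_hyperplane[OF _ facet[OF h]] P(2) ab[OF h] by blast
    have s: "affine hull ?G \<inter> open_segment p y = {}"
      using sep[OF facet[OF h]] True P(3) by auto
    have "p \<notin> ?G"
      using face_of_disjoint_interior[OF facet_of_imp_face_of[OF facet[OF h]]] facet[OF h] P(2)
      by (metis disjoint_iff facet_of_irrefl)
    then have p: "a h \<bullet> p < b h"
      using P_le[OF h, of p] P(2) interior_subset[of P] by force
    have y: "a h \<bullet> y \<le> b h"
    proof (rule ccontr)
      assume c: "\<not> a h \<bullet> y \<le> b h"
      \<comment> \<open>The parameter at which the segment from \<open>p\<close> to \<open>y\<close>
        meets the hyperplane of \<open>?G\<close>.\<close>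
      define t where "t = (b h - a h \<bullet> p) / (a h \<bullet> y - a h \<bullet> p)"
      have t: "0 < t" "t < 1" using p c by (auto simp: t_def field_simps)
      have "a h \<bullet> ((1 - t) *\<^sub>R p + t *\<^sub>R y) = a h \<bullet> p + t * (a h \<bullet> y - a h \<bullet> p)"
        by (simp add: inner_add algebra_simps)
      also have "\<dots> = b h" using p c by (simp add: t_def)
      finally have "(1 - t) *\<^sub>R p + t *\<^sub>R y \<in> affine hull ?G" using G by simp
      moreover have "(1 - t) *\<^sub>R p + t *\<^sub>R y \<in> open_segment p y"
        using t p c by (auto simp: in_segment)
      ultimately show False using s by blast
    qed
    have "\<forall>\<^sub>F e in at_right (0::real). e > 0" by (simp add: eventually_at_right_less)
    then show ?thesis
    proof (rule eventually_mono)
      fix e :: real assume "e > 0"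
      then have "e * (a h \<bullet> y - b h) \<le> 0" using y by (simp add: mult_le_0_iff)
      then show "a h \<bullet> (x + e *\<^sub>R (y - x)) \<le> b h"
        using True by (simp add: inner_add inner_diff)
    qed
  qed
  have "\<forall>\<^sub>F e in at_right 0. e > 0 \<and> (\<forall>h\<in>F. a h \<bullet> (x + e *\<^sub>R (y - x)) \<le> b h)"
    using F(1) ex by (intro eventually_conj eventually_at_right_less eventually_ball_finite) auto
  then obtain e where e: "e > 0" "\<And>h. h \<in> F \<Longrightarrow> a h \<bullet> (x + e *\<^sub>R (y - x)) \<le> b h"
    using eventually_happens'[of "at_right (0::real)"] by (metis (no_types, lifting) trivial_limit_at_right_real)
  have "x + e *\<^sub>R (y - x) \<in> h" if "h \<in> F" for h
    using e(2)[OF that] ab[OF that] by blast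
  then have "x + e *\<^sub>R (y - x) \<in> P" using F(2) aff by auto
  then show ?thesis using that e(1) by blast
qed

section \<open>Edges at a vertex\<close>

lemma polytope_eq_hull_vertices:
  fixes P :: "'a::euclidean_space set"
  assumes "polytope P"
  shows "P = convex hull (vertices P)"
  unfolding vertices_def
  using Krein_Milman_Minkowski assms polytope_imp_compact polytope_imp_convex by blast

lemma finite_vertices:
  fixes P :: "'a::euclidean_space set"
  assumes "polytope P"
  shows "finite (vertices P)"
  unfolding vertices_def
  using assms finite_polyhedron_extreme_points polytope_imp_polyhedron by blast

lemma vertices_face:
  fixes P :: "'a::euclidean_space set"
  assumes "K face_of P"
  shows "vertices K = vertices P \<inter> K"
  unfolding vertices_def using extreme_point_of_face[OF assms] by blast

lemma vertices_subset: "vertices P \<subseteq> P"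
  by (auto simp: vertices_def extreme_point_of_def)

text \<open>The smallest face \<open>L\<close> containing \<open>z\<close> has \<open>z\<close> in
  its relative interior. As \<open>z\<close> is extreme in the section, the hyperplane meets the
  affine hull of \<open>L\<close> only in \<open>z\<close>; as \<open>z\<close> is no vertex,
  \<open>L\<close> must be an edge crossing the hyperplane.\<close>

lemma polytope_hyperplane_section_extreme:
  fixes P :: "'a::euclidean_space set"
  assumes P: "polytope P" and z: "z extreme_point_of (P \<inter> {x. m \<bullet> x = c})"
    and nv: "\<not> z extreme_point_of P"
  obtains x y where "closed_segment x y edge_of P" "x \<in> vertices P" "y \<in> vertices P"
    "z \<in> open_segment x y" "m \<bullet> x < c" "c < m \<bullet> y"
proof -
  have zP: "z \<in> P" "m \<bullet> z = c" using z by (auto simp: extreme_point_of_def)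
  define L where "L = \<Inter>{K. K face_of P \<and> z \<in> K}"
  have LP: "L face_of P"
    unfolding L_def using zP face_of_refl[OF polytope_imp_convex[OF P]]
    by (intro face_of_Inter) auto
  have zL: "z \<in> L" by (auto simp: L_def)
  have Lmin: "L \<subseteq> K" if "K face_of P" "z \<in> K" for K using that by (auto simp: L_def)
  have polL: "polytope L" using face_of_polytope_polytope[OF P LP] .
  have zri: "z \<in> rel_interior L"
  proof (rule ccontr)
    assume "z \<notin> rel_interior L"
    then obtain G where G: "G facet_of L" "z \<in> G"
      using rel_boundary_of_polyhedron[OF polytope_imp_polyhedron[OF polL]] zL by blast
    then have "L \<subseteq> G" using Lmin face_of_trans[OF facet_of_imp_face_of LP] by blast
    then show False using G facet_of_imp_subset[of G L] by auto
  qed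
  \<comment> \<open>Given another common point \<open>y\<close>, equally long steps from
    \<open>z\<close> towards and away from \<open>y\<close> would stay in \<open>L\<close> and in
    the hyperplane, making \<open>z\<close> the midpoint of two points of the section.\<close>
  have sec: "affine hull L \<inter> {x. m \<bullet> x = c} = {z}"
  proof
    show "{z} \<subseteq> affine hull L \<inter> {x. m \<bullet> x = c}" using zL zP by (simp add: hull_inc)
    show "affine hull L \<inter> {x. m \<bullet> x = c} \<subseteq> {z}"
    proof
      fix y assume y: "y \<in> affine hull L \<inter> {x. m \<bullet> x = c}"
      obtain r where r: "r > 0" "cball z r \<inter> affine hull L \<subseteq> L"
        using zri mem_rel_interior_cball by blast
      show "y \<in> {z}"
      proof (rule ccontr)
        assume ny: "y \<notin> {z}"
        define e where "e = r / norm (y - z)"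
        have e: "e > 0" "e * norm (y - z) = r" using r ny by (auto simp: e_def)
        have in_L: "z + t *\<^sub>R (y - z) \<in> L \<inter> {x. m \<bullet> x = c}" if "\<bar>t\<bar> = e" for t
        proof -
          have "(1 - t) *\<^sub>R z + t *\<^sub>R y \<in> affine hull L"
            using y zL by (intro mem_affine[OF affine_affine_hull]) (auto simp: hull_inc)
          then have "z + t *\<^sub>R (y - z) \<in> affine hull L" by (simp add: algebra_simps)
          moreover have "z + t *\<^sub>R (y - z) \<in> cball z r" using e that by (simp add: dist_norm)
          ultimately show ?thesis using r(2) y zP by (auto simp: inner_add inner_diff)
        qed
        let ?p = "z + e *\<^sub>R (y - z)" and ?q = "z + (- e) *\<^sub>R (y - z)"
        have "?p \<in> P \<inter> {x. m \<bullet> x = c}" "?q \<in> P \<inter> {x. m \<bullet> x = c}"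
          using in_L[of e] in_L[of "- e"] e(1) face_of_imp_subset[OF LP] by auto
        moreover have "z = midpoint ?p ?q" by (simp add: midpoint_def algebra_simps scaleR_2[symmetric])
        moreover have "?p \<noteq> ?q" using e(1) ny by (simp add: algebra_simps)
          (metis (no_types, lifting) ny add_diff_cancel_right' diff_add_cancel scaleR_cancel_left scaleR_left_distrib double_zero less_irrefl insertI1)
        ultimately show False
          using z midpoint_in_open_segment[of ?p ?q] unfolding extreme_point_of_def by metis
      qed
    qed
  qed
  \<comment> \<open>Slicing by a hyperplane lowers the dimension by at most one here, so
    \<open>L\<close> has dimension 0 or 1; dimension 0 would make \<open>z\<close> a vertex of
    \<open>P\<close>.\<close>
  have "L \<noteq> {z}" using LP nv face_of_singleton by blast
  moreover have "aff_dim (affine hull L \<inter> {x. m \<bullet> x = c}) = 0" using sec by simp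
  ultimately have dimL: "aff_dim L = 1"
    using aff_dim_affine_Int_hyperplane[OF affine_affine_hull, of L m c] sec zL aff_dim_eq_0[of L]
    by (auto split: if_splits)
  have "collinear L" using dimL collinear_aff_dim[of L] by simp
  then obtain x y where xy: "L = closed_segment x y"
    using compact_convex_collinear_segment[of L] zL polL polytope_imp_compact polytope_imp_convex by blast
  have edge: "closed_segment x y edge_of P" "closed_segment y x edge_of P"
    using LP dimL xy by (auto simp: edge_of_def closed_segment_commute)
  have v: "x \<in> vertices P" "y \<in> vertices P"
    using segment_face_of LP xy by (auto simp: vertices_def)
  have "z \<noteq> x" "z \<noteq> y" using nv v by (auto simp: vertices_def)
  then have zo: "z \<in> open_segment x y" using zL xy by (simp add: open_segment_def)
  then obtain t where t: "0 < t" "t < 1" "z = (1 - t) *\<^sub>R x + t *\<^sub>R y" "x \<noteq> y"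
    by (auto simp: in_segment)
  have "x \<in> L" "y \<in> L" using xy by auto
  moreover have "p = z" if "p \<in> L" "m \<bullet> p = c" for p
  proof -
    have "p \<in> affine hull L \<inter> {x. m \<bullet> x = c}" using that by (simp add: hull_inc)
    then show ?thesis using sec by simp
  qed
  ultimately have ne: "m \<bullet> x \<noteq> c" "m \<bullet> y \<noteq> c" using \<open>z \<noteq> x\<close> \<open>z \<noteq> y\<close> by blast+
  \<comment> \<open>The two differences are nonzero and have a vanishing combination with positive
    weights, so their signs are opposite.\<close>
  have eq: "(1 - t) * (m \<bullet> x - c) + t * (m \<bullet> y - c) = 0"
    using zP t(3) by (simp add: inner_add algebra_simps)
  show ?thesis
  proof (cases "m \<bullet> x < c")
    case True
    then have "(1 - t) * (m \<bullet> x - c) < 0" using t by (simp add: mult_less_0_iff)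
    then have "m \<bullet> y > c" using eq t(1) by (smt (verit) mult_nonneg_nonpos)
    then show ?thesis using that edge v zo True by blast
  next
    case False
    then have "(1 - t) * (m \<bullet> x - c) > 0" using t ne by simp
    then have "m \<bullet> y < c" using eq t(1) by (smt (verit) mult_nonneg_nonneg)
    then show ?thesis using that[OF edge(2) v(2,1)] zo False ne by (auto simp: open_segment_commute)
  qed
qed

text \<open>A hyperplane \<open>m = c\<close> cuts \<open>a\<close> off from the other vertices. The
  extreme points of the section lie on edges at \<open>a\<close>, which gives the bound on the
  section; the segment from \<open>a\<close> to any other vertex passes through the section, which
  carries the bound over to that vertex.\<close>

lemma vertex_min_of_neighbours_min:
  fixes P :: "'a::euclidean_space set"
  assumes P: "polytope P" and a: "a \<in> vertices P"
    and nb: "\<And>w. w \<in> neighbours P a \<Longrightarrow> n \<bullet> a \<le> n \<bullet> w"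
    and x: "x \<in> P"
  shows "n \<bullet> a \<le> n \<bullet> x"
proof -
  let ?V = "vertices P - {a}"
  have "a \<notin> convex hull ?V"
  proof
    assume "a \<in> convex hull ?V"
    moreover have "convex hull ?V \<subseteq> P"
      using hull_mono[of ?V "vertices P" convex] polytope_eq_hull_vertices[OF P] by blast
    ultimately have "a extreme_point_of (convex hull ?V)"
      using a by (auto simp: vertices_def extreme_point_of_def)
    then show False using extreme_point_of_convex_hull by blast
  qed
  then obtain m c where m: "m \<bullet> a < c" "\<And>y. y \<in> convex hull ?V \<Longrightarrow> c < m \<bullet> y"
    using separating_hyperplane_closed_point[of "convex hull ?V" a]
      compact_imp_closed[OF finite_imp_compact_convex_hull[of ?V]] finite_vertices[OF P] by auto
  have V: "c < m \<bullet> y" if "y \<in> ?V" for y using m(2) that hull_inc[of y ?V convex] by blast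
  let ?S = "P \<inter> {x. m \<bullet> x = c}"
  have ext: "n \<bullet> a \<le> n \<bullet> z" if z: "z extreme_point_of ?S" for z
  proof -
    have "m \<bullet> z = c" using z by (auto simp: extreme_point_of_def)
    then have "\<not> z extreme_point_of P" using m V by (force simp: vertices_def)
    then obtain p q where pq: "closed_segment p q edge_of P" "p \<in> vertices P" "q \<in> vertices P"
      "z \<in> open_segment p q" "m \<bullet> p < c"
      using polytope_hyperplane_section_extreme[OF P z] by blast
    have "p = a" using pq V by force
    then have "n \<bullet> a \<le> n \<bullet> q" using nb pq by (simp add: neighbours_def)
    moreover obtain t where t: "0 < t" "t < 1" "z = (1 - t) *\<^sub>R a + t *\<^sub>R q"
      using pq(4) \<open>p = a\<close> by (auto simp: in_segment)
    ultimately have "t * (n \<bullet> a) \<le> t * (n \<bullet> q)" by simp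
    then show ?thesis unfolding t(3) by (simp add: inner_add algebra_simps)
  qed
  have S: "?S \<subseteq> {z. n \<bullet> a \<le> n \<bullet> z}"
  proof -
    have "compact ?S"
      by (intro compact_Int_closed polytope_imp_compact[OF P] closed_hyperplane)
    moreover have "convex ?S"
      by (intro convex_Int polytope_imp_convex[OF P] convex_hyperplane)
    ultimately have "?S = convex hull {z. z extreme_point_of ?S}" by (rule Krein_Milman_Minkowski)
    moreover have "convex hull {z. z extreme_point_of ?S} \<subseteq> {z. n \<bullet> a \<le> n \<bullet> z}"
      using ext by (intro hull_minimal) (auto simp: convex_halfspace_ge)
    ultimately show ?thesis by simp
  qed
  have "n \<bullet> a \<le> n \<bullet> y" if "y \<in> vertices P" for y
  proof (cases "y = a")
    case False
    then have y: "c < m \<bullet> y" using V that by blast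
    define t where "t = (c - m \<bullet> a) / (m \<bullet> y - m \<bullet> a)"
    have t: "0 < t" "t \<le> 1" using m y by (auto simp: t_def field_simps)
    let ?s = "a + t *\<^sub>R (y - a)"
    have "?s \<in> P"
      using step_in_convex[OF polytope_imp_convex[OF P], of a y t] a that t vertices_subset[of P] by auto
    moreover have "m \<bullet> ?s = c"
    proof -
      have "t * (m \<bullet> y - m \<bullet> a) = c - m \<bullet> a" using m y by (simp add: t_def)
      then show ?thesis by (simp add: inner_add inner_diff)
    qed
    ultimately have "n \<bullet> a \<le> n \<bullet> ?s" using S by blast
    then have "0 \<le> t * (n \<bullet> y - n \<bullet> a)" by (simp add: inner_add inner_diff)
    then show ?thesis using t by (simp add: zero_le_mult_iff)
  qed simp
  then have "convex hull (vertices P) \<subseteq> {z. n \<bullet> a \<le> n \<bullet> z}"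
    by (intro hull_minimal) (auto simp: convex_halfspace_ge)
  then show ?thesis using polytope_eq_hull_vertices[OF P] x by blast
qed

section \<open>Projective maps\<close>

text \<open>\<open>T\<close> is the lift of \<open>f\<close> to homogeneous coordinates and
  \<open>s\<close> its denominator. With \<open>s\<close> positive, convex combinations are mapped
  to convex combinations with rescaled weights.\<close>

locale projective_map =
  fixes S :: "'a::euclidean_space set" and f :: "'a \<Rightarrow> 'a"
    and T :: "'a \<times> real \<Rightarrow> 'a \<times> real" and s :: "'a \<Rightarrow> real"
  assumes convex_S: "convex S" and linear_T: "linear T" and bij_T: "bij T"
    and s_pos: "x \<in> S \<Longrightarrow> s x > 0"
    and T_eq: "x \<in> S \<Longrightarrow> T (x, 1) = s x *\<^sub>R (f x, 1)"
begin

lemma inj: "inj_on f S"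
proof (rule inj_onI)
  fix x y assume xy: "x \<in> S" "y \<in> S" "f x = f y"
  have "T ((1 / s x) *\<^sub>R (x, 1)) = T ((1 / s y) *\<^sub>R (y, 1))"
    using xy s_pos[of x] s_pos[of y] by (simp only: linear_cmul[OF linear_T] T_eq) simp
  then have "(1 / s x) *\<^sub>R (x, 1::real) = (1 / s y) *\<^sub>R (y, 1)"
    using bij_T by (simp only: bij_is_inj inj_eq)
  then have "1 / s x = 1 / s y" "(1 / s x) *\<^sub>R x = (1 / s y) *\<^sub>R y" by auto
  then have "(1 / s x) *\<^sub>R x = (1 / s x) *\<^sub>R y" by metis
  then show "x = y" using s_pos[of x] xy by simp
qed

lemma combination:
  assumes "x \<in> S" "y \<in> S" "0 \<le> t" "t \<le> 1"
  shows "s ((1 - t) *\<^sub>R x + t *\<^sub>R y) = (1 - t) * s x + t * s y"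
    and "s ((1 - t) *\<^sub>R x + t *\<^sub>R y) *\<^sub>R f ((1 - t) *\<^sub>R x + t *\<^sub>R y) =
      ((1 - t) * s x) *\<^sub>R f x + (t * s y) *\<^sub>R f y"
proof -
  let ?z = "(1 - t) *\<^sub>R x + t *\<^sub>R y"
  have "?z \<in> S" using convexD_alt[OF convex_S assms] by simp
  then have "s ?z *\<^sub>R (f ?z, 1) = T (?z, 1)" by (simp add: T_eq)
  also have "(?z, 1::real) = (1 - t) *\<^sub>R (x, 1) + t *\<^sub>R (y, 1)" by simp
  also have "T \<dots> = (1 - t) *\<^sub>R (s x *\<^sub>R (f x, 1)) + t *\<^sub>R (s y *\<^sub>R (f y, 1))"
    by (simp only: linear_add[OF linear_T] linear_cmul[OF linear_T] T_eq assms)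
  finally have "s ?z *\<^sub>R (f ?z, 1) = (1 - t) *\<^sub>R (s x *\<^sub>R (f x, 1)) + t *\<^sub>R (s y *\<^sub>R (f y, 1::real))" .
  then show "s ?z = (1 - t) * s x + t * s y" 
    "s ?z *\<^sub>R f ?z = ((1 - t) * s x) *\<^sub>R f x + (t * s y) *\<^sub>R f y"
    by auto
qed

text \<open>In homogeneous coordinates the weights \<open>1 - t\<close> and \<open>t\<close> become
  \<open>(1 - t) * s x\<close> and \<open>t * s y\<close>. Normalising their sum to 1 reparametrises
  the open unit interval onto itself.\<close>

lemma image_open_segment:
  assumes x: "x \<in> S" and y: "y \<in> S"
  shows "f ` open_segment x y = open_segment (f x) (f y)"
proof (cases "x = y")
  case False
  then have ne: "f x \<noteq> f y" using inj x y by (auto dest: inj_onD)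
  note pos = s_pos[OF x] s_pos[OF y]
  \<comment> \<open>The relation between \<open>t\<close> and \<open>r\<close> is cleared of
    denominators so that it can be solved for either parameter.\<close>
  have im: "f ((1 - t) *\<^sub>R x + t *\<^sub>R y) = (1 - r) *\<^sub>R f x + r *\<^sub>R f y"
    if t: "0 < t" "t < 1" and r: "r * ((1 - t) * s x + t * s y) = t * s y" for t r
  proof -
    let ?z = "(1 - t) *\<^sub>R x + t *\<^sub>R y" and ?q = "(1 - t) * s x + t * s y"
    have q: "?q > 0" using pos t by (simp add: add_pos_pos)
    have r': "(1 - r) * ?q = (1 - t) * s x" using r by (simp add: algebra_simps)
    have "?q *\<^sub>R f ?z = ((1 - r) * ?q) *\<^sub>R f x + (r * ?q) *\<^sub>R f y"
      using combination[OF x y, of t] t by (simp only: r r' less_imp_le)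
    also have "\<dots> = ?q *\<^sub>R ((1 - r) *\<^sub>R f x + r *\<^sub>R f y)"
      by (simp add: scaleR_add_right mult.commute)
    finally show ?thesis using q by (metis less_irrefl scaleR_cancel_left)
  qed
  show ?thesis
  proof
    show "f ` open_segment x y \<subseteq> open_segment (f x) (f y)"
    proof clarify
      fix z assume "z \<in> open_segment x y"
      then obtain t where t: "0 < t" "t < 1" "z = (1 - t) *\<^sub>R x + t *\<^sub>R y"
        by (auto simp: in_segment)
      have q: "(1 - t) * s x + t * s y > 0" using pos t by (simp add: add_pos_pos)
      define r where "r = t * s y / ((1 - t) * s x + t * s y)"
      have "0 < r" "r < 1" using q pos t by (auto simp: r_def field_simps)
      moreover have "f z = (1 - r) *\<^sub>R f x + r *\<^sub>R f y"
        unfolding t(3) using t q by (intro im) (auto simp: r_def)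
      ultimately show "f z \<in> open_segment (f x) (f y)" using ne by (auto simp: in_segment)
    qed
    show "open_segment (f x) (f y) \<subseteq> f ` open_segment x y"
    proof
      fix w assume "w \<in> open_segment (f x) (f y)"
      then obtain r where r: "0 < r" "r < 1" "w = (1 - r) *\<^sub>R f x + r *\<^sub>R f y"
        by (auto simp: in_segment)
      have q: "(1 - r) * s y + r * s x > 0" using pos r by (simp add: add_pos_pos)
      define t where "t = r * s x / ((1 - r) * s y + r * s x)"
      have t: "0 < t" "t < 1" using q pos r by (auto simp: t_def field_simps)
      have tq: "t * ((1 - r) * s y + r * s x) = r * s x" using q by (simp add: t_def)
      have "w = f ((1 - t) *\<^sub>R x + t *\<^sub>R y)"
        unfolding r(3) using t tq by (intro im[symmetric]) (auto simp: algebra_simps)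
      moreover have "(1 - t) *\<^sub>R x + t *\<^sub>R y \<in> open_segment x y"
        using t False by (auto simp: in_segment)
      ultimately show "w \<in> f ` open_segment x y" by blast
    qed
  qed
qed simp

lemma image_closed_segment:
  assumes "x \<in> S" "y \<in> S"
  shows "f ` closed_segment x y = closed_segment (f x) (f y)"
  using image_open_segment[OF assms] by (simp add: closed_segment_eq_open image_Un)

lemma convex_image:
  assumes "C \<subseteq> S" "convex C"
  shows "convex (f ` C)"
  unfolding convex_contains_segment
proof clarify
  fix x y w assume "x \<in> C" "y \<in> C" "w \<in> closed_segment (f x) (f y)"
  then show "w \<in> f ` C"
    using image_closed_segment[of x y] assms closed_segment_subset[of x C y] by blast
qed

lemma convex_vimage:
  assumes "convex D"
  shows "convex {x \<in> S. f x \<in> D}"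
  unfolding convex_contains_segment
proof (intro ballI subsetI)
  fix x y z assume "x \<in> {x \<in> S. f x \<in> D}" "y \<in> {x \<in> S. f x \<in> D}" "z \<in> closed_segment x y"
  then show "z \<in> {x \<in> S. f x \<in> D}"
    using image_closed_segment[of x y] assms closed_segment_subset[of "f x" D "f y"]
      closed_segment_subset[OF _ _ convex_S, of x y] by blast
qed

lemma image_convex_hull:
  assumes "X \<subseteq> S"
  shows "f ` (convex hull X) = convex hull (f ` X)"
proof
  have "convex hull X \<subseteq> {x \<in> S. f x \<in> convex hull (f ` X)}"
    using assms by (intro hull_minimal convex_vimage) (auto simp: hull_inc)
  then show "f ` (convex hull X) \<subseteq> convex hull (f ` X)" by blast
  have "convex hull X \<subseteq> S" using assms convex_S by (simp add: hull_minimal)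
  then show "convex hull (f ` X) \<subseteq> f ` (convex hull X)"
    using assms convex_image[of "convex hull X"] by (intro hull_minimal) (auto simp: hull_inc)
qed

lemma face_image:
  assumes "K face_of S"
  shows "f ` K face_of f ` S"
  unfolding face_of_def
proof (intro conjI ballI impI)
  have KS: "K \<subseteq> S" using assms face_of_imp_subset by blast
  then show "f ` K \<subseteq> f ` S" by blast
  show "convex (f ` K)" using convex_image KS assms face_of_imp_convex by blast
  fix p q y assume "p \<in> f ` S" "q \<in> f ` S" "y \<in> f ` K" "y \<in> open_segment p q"
  then obtain a b x where ab: "a \<in> S" "b \<in> S" "x \<in> K" "p = f a" "q = f b" "y = f x"
    "f x \<in> open_segment (f a) (f b)" by blast
  then obtain z where "z \<in> open_segment a b" "f x = f z"
    using image_open_segment[of a b] by blast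
  moreover have "z \<in> S"
    using calculation ab convex_S open_closed_segment closed_segment_subset[of a S b] by blast
  ultimately have "x \<in> open_segment a b" using inj ab KS by (metis inj_onD subsetD)
  then have "a \<in> K \<and> b \<in> K" using face_ofD[OF assms] ab by blast
  then show "p \<in> f ` K" "q \<in> f ` K" using ab by blast+
qed

text \<open>Affine dependence of points is linear dependence of their lifts \<open>(x, 1)\<close>.
  Applying \<open>T\<close> preserves it and multiplies the coefficient of \<open>x\<close> by the
  nonzero factor \<open>s x\<close>.\<close>

lemma affine_dependent_image:
  assumes "X \<subseteq> S" "affine_dependent X"
  shows "affine_dependent (f ` X)"
proof -
  obtain U u where U: "finite U" "U \<subseteq> X" "sum u U = 0" "\<exists>v\<in>U. u v \<noteq> 0" "(\<Sum>v\<in>U. u v *\<^sub>R v) = 0"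
    using assms(2) unfolding affine_dependent_explicit by blast
  have US: "U \<subseteq> S" using U assms by blast
  have injU: "inj_on f U" using inj US inj_on_subset by blast
  have "(\<Sum>v\<in>U. u v *\<^sub>R (v, 1::real)) = 0"
    using U by (simp add: prod_eq_iff fst_sum snd_sum)
  then have "T (\<Sum>v\<in>U. u v *\<^sub>R (v, 1::real)) = 0" using linear_0[OF linear_T] by simp
  moreover have "T (\<Sum>v\<in>U. u v *\<^sub>R (v, 1::real)) = (\<Sum>v\<in>U. u v *\<^sub>R T (v, 1))"
    by (simp only: linear_sum[OF linear_T] linear_cmul[OF linear_T])
  moreover have "(\<Sum>v\<in>U. u v *\<^sub>R T (v, 1)) = (\<Sum>v\<in>U. (u v * s v) *\<^sub>R (f v, 1))"
    using US T_eq by (intro sum.cong) auto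
  ultimately have *: "(\<Sum>v\<in>U. (u v * s v) *\<^sub>R (f v, 1::real)) = 0" by simp
  let ?u = "\<lambda>y. u (inv_into U f y) * s (inv_into U f y)"
  have "sum ?u (f ` U) = (\<Sum>v\<in>U. u v * s v)"
    using injU by (simp add: sum.reindex)
  also have "\<dots> = 0" using arg_cong[OF *, of snd] by (simp add: snd_sum)
  finally have 1: "sum ?u (f ` U) = 0" .
  have "(\<Sum>y\<in>f ` U. ?u y *\<^sub>R y) = (\<Sum>v\<in>U. (u v * s v) *\<^sub>R f v)"
    using injU by (simp add: sum.reindex)
  also have "\<dots> = 0" using arg_cong[OF *, of fst] by (simp add: fst_sum)
  finally have 2: "(\<Sum>y\<in>f ` U. ?u y *\<^sub>R y) = 0" .
  obtain v where v: "v \<in> U" "u v \<noteq> 0" using U(4) by blast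
  then have "?u (f v) \<noteq> 0" using injU s_pos[of v] US by auto
  then have 3: "\<exists>y\<in>f ` U. ?u y \<noteq> 0" using v by blast
  show ?thesis
    unfolding affine_dependent_explicit using U(1,2) 1 2 3 by blast
qed

text \<open>With the inverse map in the same class, each one-sided statement about images also
  yields its converse.\<close>

lemma inverse: "projective_map (f ` S) (inv_into S f) (inv T) (\<lambda>y. 1 / s (inv_into S f y))"
proof (rule projective_map.intro)
  show "convex (f ` S)" using convex_image convex_S by blast
  show "linear (inv T)" using linear_T bij_T by (simp add: bij_is_inj inj_linear_imp_inv_linear)
  show "bij (inv T)" using bij_T by (simp add: bij_imp_bij_inv)
  fix y assume "y \<in> f ` S"
  then obtain x where x: "x \<in> S" "y = f x" by blast
  have ix: "inv_into S f y = x" using x inj by simp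
  show "1 / s (inv_into S f y) > 0" using x ix s_pos by simp
  have "T ((1 / s x) *\<^sub>R (x, 1)) = (y, 1)"
    using x s_pos[of x] by (simp only: linear_cmul[OF linear_T] T_eq) simp
  then show "inv T (y, 1) = (1 / s (inv_into S f y)) *\<^sub>R (inv_into S f y, 1)"
    using bij_T ix by (metis bij_inv_eq_iff)
qed

lemma affine_dependent_image_iff:
  assumes "X \<subseteq> S"
  shows "affine_dependent (f ` X) \<longleftrightarrow> affine_dependent X"
proof -
  interpret inv: projective_map "f ` S" "inv_into S f" "inv T" "\<lambda>y. 1 / s (inv_into S f y)"
    by (rule inverse)
  have "inv_into S f ` f ` X = X" using assms inj by (simp add: inv_into_image_cancel)
  then show ?thesis
    using affine_dependent_image[OF assms] inv.affine_dependent_image[of "f ` X"] assms by auto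
qed

lemma aff_dim_image_ge:
  assumes "X \<subseteq> S"
  shows "aff_dim X \<le> aff_dim (f ` X)"
proof -
  obtain B where B: "B \<subseteq> X" "\<not> affine_dependent B" "affine hull B = affine hull X"
    using affine_basis_exists[of X] by metis
  have "aff_dim X = int (card B) - 1"
    using B(3) aff_dim_affine_independent[OF B(2)] aff_dim_affine_hull[of B] aff_dim_affine_hull[of X] by simp
  also have "card B = card (f ` B)"
    using B(1) assms inj by (metis card_image inj_on_subset subset_trans)
  also have "int (card (f ` B)) - 1 = aff_dim (f ` B)"
    using aff_dim_affine_independent[of "f ` B"] affine_dependent_image_iff[of B] B assms by simp
  also have "\<dots> \<le> aff_dim (f ` X)" using B by (intro aff_dim_subset) blast
  finally show ?thesis .
qed

lemma aff_dim_image: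
  assumes "X \<subseteq> S"
  shows "aff_dim (f ` X) = aff_dim X"
proof -
  interpret inv: projective_map "f ` S" "inv_into S f" "inv T" "\<lambda>y. 1 / s (inv_into S f y)"
    by (rule inverse)
  have "inv_into S f ` f ` X = X" using assms inj by (simp add: inv_into_image_cancel)
  then show ?thesis
    using aff_dim_image_ge[OF assms] inv.aff_dim_image_ge[OF image_mono[OF assms]] by simp
qed

lemma face_of_image_iff:
  assumes "K \<subseteq> S"
  shows "f ` K face_of f ` S \<longleftrightarrow> K face_of S"
proof -
  interpret inv: projective_map "f ` S" "inv_into S f" "inv T" "\<lambda>y. 1 / s (inv_into S f y)"
    by (rule inverse)
  have "inv_into S f ` f ` K = K" "inv_into S f ` f ` S = S"
    using assms inj by (simp_all add: inv_into_image_cancel)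
  then show ?thesis
    using face_image[of K] inv.face_image[of "f ` K"] by metis
qed

lemma face_of_imageE:
  assumes "L face_of f ` S"
  obtains K where "K face_of S" "L = f ` K"
proof -
  let ?K = "{x \<in> S. f x \<in> L}"
  have "L = f ` ?K" using face_of_imp_subset[OF assms] by blast
  then show ?thesis using that[of ?K] face_of_image_iff[of ?K] assms by auto
qed

lemma facet_of_image_iff:
  assumes "G \<subseteq> S"
  shows "f ` G facet_of f ` S \<longleftrightarrow> G facet_of S"
  by (simp add: facet_of_def face_of_image_iff[OF assms] aff_dim_image[OF assms] aff_dim_image)

lemma vertices_image: "vertices (f ` S) = f ` vertices S"
proof (intro set_eqI)
  fix y
  show "y \<in> vertices (f ` S) \<longleftrightarrow> y \<in> f ` vertices S"
  proof (cases "y \<in> f ` S")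
    case True
    then obtain x where x: "x \<in> S" "y = f x" by blast
    have "y \<in> vertices (f ` S) \<longleftrightarrow> f ` {x} face_of f ` S"
      using x by (simp add: vertices_def face_of_singleton)
    also have "\<dots> \<longleftrightarrow> x \<in> vertices S"
      using x face_of_image_iff[of "{x}"] by (simp add: vertices_def face_of_singleton)
    also have "\<dots> \<longleftrightarrow> y \<in> f ` vertices S"
      using x inj vertices_subset[of S] by (auto dest: inj_onD)
    finally show ?thesis .
  qed (use vertices_subset in blast)
qed

lemma neighbours_image:
  assumes "v \<in> S"
  shows "neighbours (f ` S) (f v) = f ` neighbours S v"
proof -
  have "closed_segment (f v) (f w) edge_of f ` S \<longleftrightarrow> closed_segment v w edge_of S"
    if "w \<in> S" for w
  proof -
    have "closed_segment v w \<subseteq> S"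
      using assms that convex_S by (simp add: closed_segment_subset)
    then show ?thesis
      using face_of_image_iff[of "closed_segment v w"] aff_dim_image[of "closed_segment v w"]
        image_closed_segment[OF assms that] by (simp add: edge_of_def)
  qed
  then show ?thesis
    using vertices_image vertices_subset[of S] by (auto simp: neighbours_def)
qed

lemma simplex_image:
  assumes "K \<subseteq> S" "n simplex K"
  shows "n simplex (f ` K)"
proof -
  obtain C where C: "\<not> affine_dependent C" "int (card C) = n + 1" "K = convex hull C"
    using assms(2) by (auto simp: simplex_def)
  have CS: "C \<subseteq> S" using C(3) assms(1) hull_subset[of C convex] by blast
  have "f ` K = convex hull (f ` C)" using C(3) image_convex_hull[OF CS] by simp
  moreover have "card (f ` C) = card C" using CS inj by (metis card_image inj_on_subset)
  ultimately show ?thesis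
    unfolding simplex_def using affine_dependent_image_iff[OF CS] C by metis
qed

lemma polytope_image:
  assumes "polytope S"
  shows "polytope (f ` S)"
proof -
  obtain V where V: "finite V" "S = convex hull V" using assms by (auto simp: polytope_def)
  then have "f ` S = convex hull (f ` V)" using image_convex_hull[of V] hull_subset[of V convex] by simp
  then show ?thesis using V(1) by (auto simp: polytope_def)
qed

lemma d_polytope_image: "d_polytope d S \<Longrightarrow> d_polytope d (f ` S)"
  by (simp add: d_polytope_def polytope_image aff_dim_image)

lemma j_simplicial_image:
  assumes "j_simplicial d j S"
  shows "j_simplicial d j (f ` S)"
  unfolding j_simplicial_def
proof (intro conjI allI impI)
  show "d_polytope d (f ` S)" using assms d_polytope_image by (simp add: j_simplicial_def)
  fix L assume L: "L face_of f ` S \<and> aff_dim L = int j"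
  then obtain K where K: "K face_of S" "L = f ` K" using face_of_imageE by blast
  then have "K \<subseteq> S" using face_of_imp_subset by blast
  then show "int j simplex L"
    using K L assms aff_dim_image[of K] simplex_image[of K] by (simp add: j_simplicial_def)
qed

lemma i_simple_image:
  assumes "i_simple d i S"
  shows "i_simple d i (f ` S)"
  unfolding i_simple_def
proof (intro conjI allI impI)
  show "d_polytope d (f ` S)" using assms d_polytope_image by (simp add: i_simple_def)
  fix L assume L: "L face_of f ` S \<and> aff_dim L = int d - int i - 1"
  then obtain K where K: "K face_of S" "L = f ` K" using face_of_imageE by blast
  then have KS: "K \<subseteq> S" using face_of_imp_subset by blast
  have "bij_betw ((`) f) {H. H facet_of S \<and> K \<subseteq> H} {H. H facet_of f ` S \<and> L \<subseteq> H}"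
  proof (rule bij_betw_imageI)
    have sub: "H \<subseteq> S" if "H facet_of S" for H using that facet_of_imp_subset by blast
    show "inj_on ((`) f) {H. H facet_of S \<and> K \<subseteq> H}"
      using inj sub by (auto intro!: inj_onI simp: inj_on_image_eq_iff)
    show "(`) f ` {H. H facet_of S \<and> K \<subseteq> H} = {H. H facet_of f ` S \<and> L \<subseteq> H}"
    proof (intro equalityI subsetI)
      fix H assume H: "H \<in> {H. H facet_of f ` S \<and> L \<subseteq> H}"
      then obtain G where G: "G face_of S" "H = f ` G"
        using face_of_imageE facet_of_imp_face_of by blast
      then have GS: "G \<subseteq> S" using face_of_imp_subset by blast
      then have "G facet_of S" "K \<subseteq> G"
        using H G K KS facet_of_image_iff inj by (auto simp: inj_on_image_subset_iff)
      then show "H \<in> (`) f ` {H. H facet_of S \<and> K \<subseteq> H}" using G by blast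
    qed (use sub facet_of_image_iff K in auto)
  qed
  then have "card {H. H facet_of S \<and> K \<subseteq> H} = card {H. H facet_of f ` S \<and> L \<subseteq> H}"
    by (rule bij_betw_same_card)
  then show "card {H. H facet_of f ` S \<and> L \<subseteq> H} = i + 1"
    using K L KS assms aff_dim_image[of K] by (simp add: i_simple_def)
qed

end

text \<open>The denominator is an affine function without zeros on the convex set \<open>S\<close>,
  hence of constant sign there. If it is negative, \<open>- T\<close> represents the same map with a
  positive denominator.\<close>

lemma projective_on_imp_projective_map:
  fixes f :: "'a::euclidean_space \<Rightarrow> 'a"
  assumes f: "projective_on S f" and S: "convex S"
  obtains T s where "projective_map S f T s"
proof -
  obtain T :: "'a \<times> real \<Rightarrow> 'a \<times> real" where T: "linear T" "bij T"
    and s: "\<forall>x\<in>S. snd (T (x, 1)) \<noteq> 0 \<and> f x = fst (T (x, 1)) /\<^sub>R snd (T (x, 1))"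
    using f unfolding projective_on_def by blast
  define s where "s x = snd (T (x, 1))" for x
  have T_eq: "T (x, 1) = s x *\<^sub>R (f x, 1)" if "x \<in> S" for x
    using s that by (simp add: s_def prod_eq_iff)
  have affine: "s ((1 - t) *\<^sub>R x + t *\<^sub>R y) = (1 - t) * s x + t * s y" for x y t
  proof -
    have "((1 - t) *\<^sub>R x + t *\<^sub>R y, 1::real) = (1 - t) *\<^sub>R (x, 1) + t *\<^sub>R (y, 1)" by simp
    then show ?thesis unfolding s_def
      by (simp only: linear_add[OF T(1)] linear_cmul[OF T(1)]) simp
  qed
  have same_sign: "s x * s y > 0" if "x \<in> S" "y \<in> S" for x y
  proof (rule ccontr)
    assume "\<not> s x * s y > 0"
    moreover have nz: "s x \<noteq> 0" "s y \<noteq> 0" using s that by (auto simp: s_def)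
    ultimately have opp: "s x < 0 \<and> 0 < s y \<or> s y < 0 \<and> 0 < s x"
      by (metis linorder_neqE_linordered_idom mult_neg_neg mult_pos_pos)
    \<comment> \<open>The parameter at which the affine function \<open>s\<close> would vanish
      between \<open>x\<close> and \<open>y\<close>.\<close>
    define t where "t = s x / (s x - s y)"
    have t: "0 \<le> t" "t \<le> 1" using opp by (auto simp: t_def field_simps)
    have "s ((1 - t) *\<^sub>R x + t *\<^sub>R y) = s x - t * (s x - s y)"
      unfolding affine by (simp add: algebra_simps)
    also have "\<dots> = 0" using opp by (auto simp: t_def)
    finally show False using s convexD_alt[OF S that t] by (simp add: s_def)
  qed
  show ?thesis
  proof (cases "\<forall>x\<in>S. s x > 0")
    case True
    then have "projective_map S f T s" using S T T_eq by (intro projective_map.intro) auto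
    then show ?thesis by (rule that)
  next
    case False
    then have neg: "s x < 0" if "x \<in> S" for x
      using that same_sign by (metis less_asym not_less_iff_gr_or_eq zero_less_mult_iff)
    have "projective_map S f (\<lambda>z. - T z) (\<lambda>x. - s x)"
    proof (rule projective_map.intro)
      show "linear (\<lambda>z. - T z)" using T(1) by (rule linear_compose_neg)
      show "bij (\<lambda>z. - T z)" using bij_comp[OF T(2) bij_uminus] by (simp add: comp_def)
    qed (use S T_eq neg in auto)
    then show ?thesis by (rule that)
  qed
qed

text \<open>Lets the transfer results for projective maps also serve for the affine map applied to
  \<open>P2\<close>.\<close>

lemma affine_bij_imp_projective_map:
  fixes A :: "'a::euclidean_space \<Rightarrow> 'a"
  assumes "linear A" "inj A" "convex S"
  shows "projective_map S (\<lambda>x. A x + b) (\<lambda>z. (A (fst z) + snd z *\<^sub>R b, snd z)) (\<lambda>_. 1)"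
proof (rule projective_map.intro)
  show lin: "linear (\<lambda>z. (A (fst z) + snd z *\<^sub>R b, snd z))"
    using assms(1) by (intro linearI) (auto simp: linear_add linear_cmul algebra_simps)
  have "inj (\<lambda>z. (A (fst z) + snd z *\<^sub>R b, snd z :: real))"
    using assms(2) by (auto intro!: injI simp: inj_eq prod_eq_iff)
  then show "bij (\<lambda>z. (A (fst z) + snd z *\<^sub>R b, snd z))"
    using lin by (simp add: bij_def linear_injective_imp_surjective)
qed (use assms in auto)

section \<open>The merge in normal position\<close>

text \<open>For each \<open>c\<close> the hyperplane through the other points yields an affine
  function that, rescaled, is 1 at \<open>c\<close> and 0 at the others. These functions return the
  coefficients of every affine combination of \<open>C\<close>, and the cardinality makes
  \<open>C\<close> span the whole space.\<close>

lemma barycentric_functionals: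
  fixes C :: "'a::euclidean_space set"
  assumes "\<not> affine_dependent C" "card C = DIM('a) + 1"
  obtains n :: "'a \<Rightarrow> 'a" and b :: "'a \<Rightarrow> real"
  where "\<And>c c'. c \<in> C \<Longrightarrow> c' \<in> C \<Longrightarrow> n c \<bullet> c' + b c = (if c' = c then 1 else 0)"
    "\<And>x. (\<Sum>c\<in>C. n c \<bullet> x + b c) = 1" "\<And>x. (\<Sum>c\<in>C. (n c \<bullet> x + b c) *\<^sub>R c) = x"
proof -
  have fin: "finite C" using assms(2) card.infinite by fastforce
  have "\<exists>m \<beta>. \<forall>c'\<in>C. m \<bullet> c' + \<beta> = (if c' = c then 1 else 0)" if c: "c \<in> C" for c
  proof -
    have "\<not> affine_dependent (C - {c})" using assms(1) affine_dependent_subset by blast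
    then have "aff_dim (C - {c}) = DIM('a) - 1"
      using aff_dim_affine_independent[of "C - {c}"] assms(2) c fin by (simp add: card_Diff_singleton of_nat_diff)
    then obtain m \<beta> where m: "m \<noteq> 0" "affine hull (C - {c}) = {x. m \<bullet> x = \<beta>}"
      using aff_dim_eq_hyperplane[of "C - {c}"] by auto
    have "c \<notin> affine hull (C - {c})" using assms(1) c by (auto simp: affine_dependent_def)
    then have ne: "m \<bullet> c - \<beta> \<noteq> 0" using m by simp
    have "m \<bullet> c' = \<beta>" if "c' \<in> C - {c}" for c' using m(2) hull_inc[OF that, of affine] by blast
    moreover have "(m /\<^sub>R (m \<bullet> c - \<beta>)) \<bullet> c' + (- \<beta> / (m \<bullet> c - \<beta>)) = (m \<bullet> c' - \<beta>) / (m \<bullet> c - \<beta>)" for c'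
      by (simp add: divide_inverse algebra_simps)
    ultimately have "\<forall>c'\<in>C. (m /\<^sub>R (m \<bullet> c - \<beta>)) \<bullet> c' + (- \<beta> / (m \<bullet> c - \<beta>)) = (if c' = c then 1 else 0)"
      using ne by simp
    then show ?thesis by blast
  qed
  then obtain n b where nb: "\<And>c c'. c \<in> C \<Longrightarrow> c' \<in> C \<Longrightarrow> n c \<bullet> c' + b c = (if c' = c then 1 else 0)"
    by metis
  have *: "(\<Sum>c\<in>C. n c \<bullet> x + b c) = 1 \<and> (\<Sum>c\<in>C. (n c \<bullet> x + b c) *\<^sub>R c) = x" for x
  proof -
    have "x \<in> affine hull C" using affine_independent_span_eq assms by fastforce
    then obtain u where u: "sum u C = 1" "(\<Sum>c\<in>C. u c *\<^sub>R c) = x"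
      using affine_hull_finite[OF fin] by auto
    have "n c \<bullet> x + b c = u c" if "c \<in> C" for c
    proof -
      have "n c \<bullet> x + b c = (\<Sum>c'\<in>C. u c' * (n c \<bullet> c')) + b c * sum u C"
        by (simp add: u(1) u(2)[symmetric] inner_sum_right)
      also have "\<dots> = (\<Sum>c'\<in>C. u c' * (n c \<bullet> c' + b c))"
        by (simp add: distrib_left sum.distrib sum_distrib_left mult.commute)
      also have "\<dots> = (\<Sum>c'\<in>C. if c' = c then u c' else 0)"
        using nb[OF that] by (intro sum.cong) auto
      also have "\<dots> = u c" using fin that by simp
      finally show ?thesis .
    qed
    then show ?thesis using u by simp
  qed
  show ?thesis using that[of n b] nb * by blast
qed

text \<open>A segment between the two sets is cut at its crossing point with the hyperplane. By
  \<open>cross\<close> that point lies in both sets, so each half stays within one of them.\<close>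

lemma convex_Un_crossing:
  fixes A B :: "'a::euclidean_space set"
  assumes "convex A" "convex B"
    and A: "\<And>x. x \<in> A \<Longrightarrow> 0 \<le> m \<bullet> x + \<beta>" and B: "\<And>x. x \<in> B \<Longrightarrow> m \<bullet> x + \<beta> \<le> 0"
    and cross: "\<And>p q z. p \<in> A \<Longrightarrow> q \<in> B \<Longrightarrow> z \<in> closed_segment p q \<Longrightarrow> m \<bullet> z + \<beta> = 0 \<Longrightarrow> z \<in> A \<inter> B"
  shows "convex (A \<union> B)"
proof -
  have mix: "closed_segment p q \<subseteq> A \<union> B" if pq: "p \<in> A" "q \<in> B" for p q
  proof -
    obtain z where z: "z \<in> closed_segment p q" "m \<bullet> z + \<beta> = 0"
    proof (cases "m \<bullet> p = m \<bullet> q")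
      case True
      then show ?thesis using that[of p] A[OF pq(1)] B[OF pq(2)] by simp
    next
      case False
      define t where "t = (m \<bullet> p + \<beta>) / (m \<bullet> p - m \<bullet> q)"
      have lt: "m \<bullet> p - m \<bullet> q > 0" using False A[OF pq(1)] B[OF pq(2)] by simp
      have t: "0 \<le> t" "t \<le> 1" using lt A[OF pq(1)] B[OF pq(2)] by (auto simp: t_def field_simps)
      have "t * (m \<bullet> p - m \<bullet> q) = m \<bullet> p + \<beta>" using lt by (simp add: t_def)
      then have "m \<bullet> ((1 - t) *\<^sub>R p + t *\<^sub>R q) + \<beta> = 0" by (simp add: inner_add algebra_simps)
      then show ?thesis using that[of "(1 - t) *\<^sub>R p + t *\<^sub>R q"] t by (auto simp: in_segment)
    qed
    have "z \<in> A" "z \<in> B" using cross[OF pq z] by auto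
    then have "closed_segment p z \<union> closed_segment z q \<subseteq> A \<union> B"
      using closed_segment_subset[OF pq(1) _ assms(1)] closed_segment_subset[OF _ pq(2) assms(2)] by blast
    then show ?thesis using Un_closed_segment[OF z(1)] by simp
  qed
  show ?thesis
    unfolding convex_contains_segment
  proof (intro ballI)
    fix p q assume "p \<in> A \<union> B" "q \<in> A \<union> B"
    then show "closed_segment p q \<subseteq> A \<union> B"
      using mix[of p q] mix[of q p] closed_segment_commute[of p q]
        closed_segment_subset[OF _ _ assms(1), of p q] closed_segment_subset[OF _ _ assms(2), of p q]
      by blast
  qed
qed

text \<open>Any two vertices of a simplex span an edge, and edges of a face are edges of the
  polytope, so every vertex of \<open>L\<close> other than \<open>a\<close> is a neighbour of
  \<open>a\<close>.\<close>

lemma simplex_face_subset_hull_neighbours: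
  fixes P :: "'a::euclidean_space set"
  assumes L: "L face_of P" "k simplex L" and a: "a \<in> vertices P" "a \<in> L"
  shows "L \<subseteq> convex hull (insert a (neighbours P a))"
proof -
  obtain D where D: "\<not> affine_dependent D" "L = convex hull D"
    using L(2) by (auto simp: simplex_def)
  have VD: "vertices L = D"
    using extreme_point_of_convex_hull_affine_independent[OF D(1)] by (auto simp: vertices_def D(2))
  then have aD: "a \<in> D" using vertices_face[OF L(1)] a by blast
  have "w \<in> neighbours P a" if w: "w \<in> D" "w \<noteq> a" for w
  proof -
    have "w \<in> vertices P" using vertices_face[OF L(1)] VD w by blast
    moreover have "convex hull {a, w} face_of L"
      unfolding D(2) face_of_convex_hull_affine_independent[OF D(1)]
      using aD w by (intro exI[of _ "{a, w}"]) simp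
    then have "convex hull {a, w} face_of P" using face_of_trans L(1) by blast
    moreover have "aff_dim (convex hull {a, w}) = 1" using w by (simp add: aff_dim_convex_hull)
    ultimately show ?thesis by (simp add: neighbours_def edge_of_def segment_convex_hull)
  qed
  then have "D \<subseteq> insert a (neighbours P a)" by blast
  then show ?thesis using D(2) hull_mono by blast
qed

text \<open>The situation after both transformations: \<open>insert a W\<close> is the vertex set of
  \<Sigma>, \<open>convex hull W\<close> is the image of \<open>F\<close>, and \<open>side\<close>
  describes the images of the \<open>H j\<close>. Simplicity of the vertex \<open>a\<close> appears
  as having \<open>DIM('a)\<close> neighbours that are affinely independent together with
  \<open>a\<close>.\<close>

locale merge_position =
  fixes Q1 Q2 W :: "'a::euclidean_space set" and a :: 'a and n :: "'a \<Rightarrow> 'a" and b :: "'a \<Rightarrow> real"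
  assumes indep: "\<not> affine_dependent (insert a W)" and a_notin: "a \<notin> W" and card_W: "card W = DIM('a)"
    and polytope_Q1: "polytope Q1" and Q1_simplex: "Q1 \<subseteq> convex hull (insert a W)"
    and base: "(convex hull W) facet_of Q1"
    and side: "w \<in> W \<Longrightarrow> (Q1 \<inter> affine hull (insert a W - {w})) facet_of Q1"
    and polytope_Q2: "polytope Q2" and a_vertex: "a \<in> vertices Q2" and nbrs: "neighbours Q2 a = W"
    and coord_vertex: "c \<in> insert a W \<Longrightarrow> c' \<in> insert a W \<Longrightarrow> n c \<bullet> c' + b c = (if c' = c then 1 else 0)"
    and coord_sum: "(\<Sum>c\<in>insert a W. n c \<bullet> x + b c) = 1"
    and coord_comb: "(\<Sum>c\<in>insert a W. (n c \<bullet> x + b c) *\<^sub>R c) = x"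
begin

abbreviation "C \<equiv> insert a W"

text \<open>The barycentric coordinate belonging to \<open>c\<close>; \<open>coord a\<close> is the
  height \<open>h\<close> above the common facet.\<close>

definition coord :: "'a \<Rightarrow> 'a \<Rightarrow> real" where "coord c x = n c \<bullet> x + b c"

abbreviation "R \<equiv> convex hull (vertices Q2 - {a})"

definition M where "M = Q1 \<union> R"

section \<open>Barycentric coordinates of the simplex\<close>

lemma finite_W: "finite W"
  using card_W DIM_positive[where 'a='a] card.infinite by fastforce

lemma W_ne: "W \<noteq> {}"
  using card_W DIM_positive[where 'a='a] by auto

lemma coord_at: "c \<in> C \<Longrightarrow> c' \<in> C \<Longrightarrow> coord c c' = (if c' = c then 1 else 0)"
  using coord_vertex by (simp add: coord_def)

lemma coord_step: "coord c (x + e *\<^sub>R (y - x)) = coord c x + e * (coord c y - coord c x)"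
  by (simp add: coord_def inner_add inner_diff algebra_simps)

lemma coord_convex_comb: "coord c ((1 - t) *\<^sub>R x + t *\<^sub>R y) = (1 - t) * coord c x + t * coord c y"
  by (simp add: coord_def inner_add algebra_simps)

lemma n_nonzero:
  assumes "c \<in> C"
  shows "n c \<noteq> 0"
proof
  assume "n c = 0"
  moreover obtain c' where "c' \<in> C" "c' \<noteq> c" using a_notin W_ne assms by (metis insertCI ex_in_conv insertE)
  ultimately show False using coord_vertex[OF assms assms] coord_vertex[OF assms] by force
qed

lemma convex_coord_nonneg: "convex {x. 0 \<le> coord c x}"
proof -
  have "{x. 0 \<le> coord c x} = {x. n c \<bullet> x \<ge> - b c}" by (auto simp: coord_def)
  then show ?thesis by (simp add: convex_halfspace_ge)
qed

lemma affine_coord_zero: "affine {x. coord c x = 0}"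
proof -
  have "{x. coord c x = 0} = {x. n c \<bullet> x = - b c}" by (auto simp: coord_def)
  then show ?thesis by (simp add: affine_hyperplane)
qed

lemma mem_hull_iff:
  assumes "X \<subseteq> C"
  shows "x \<in> convex hull X \<longleftrightarrow> (\<forall>c\<in>C. 0 \<le> coord c x) \<and> (\<forall>c\<in>C - X. coord c x = 0)"
proof
  assume "x \<in> convex hull X"
  moreover have "convex hull X \<subseteq> (\<Inter>c\<in>C. {x. 0 \<le> coord c x}) \<inter> (\<Inter>c\<in>C - X. {x. coord c x = 0})"
  proof (rule hull_minimal)
    show "X \<subseteq> (\<Inter>c\<in>C. {x. 0 \<le> coord c x}) \<inter> (\<Inter>c\<in>C - X. {x. coord c x = 0})"
      using assms coord_at by auto
    show "convex ((\<Inter>c\<in>C. {x. 0 \<le> coord c x}) \<inter> (\<Inter>c\<in>C - X. {x. coord c x = 0}))"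
      by (intro convex_Int convex_INT convex_coord_nonneg affine_imp_convex affine_coord_zero)
  qed
  ultimately show "(\<forall>c\<in>C. 0 \<le> coord c x) \<and> (\<forall>c\<in>C - X. coord c x = 0)" by blast
next
  assume x: "(\<forall>c\<in>C. 0 \<le> coord c x) \<and> (\<forall>c\<in>C - X. coord c x = 0)"
  have "(\<Sum>c\<in>C. coord c x) = (\<Sum>c\<in>X. coord c x)"
    using x finite_W assms by (intro sum.mono_neutral_right) auto
  then have 1: "(\<Sum>c\<in>X. coord c x) = 1" using coord_sum by (simp add: coord_def)
  have "(\<Sum>c\<in>C. coord c x *\<^sub>R c) = (\<Sum>c\<in>X. coord c x *\<^sub>R c)"
    using x finite_W assms by (intro sum.mono_neutral_right) auto
  then have 2: "(\<Sum>c\<in>X. coord c x *\<^sub>R c) = x" using coord_comb by (simp add: coord_def)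
  have "finite X" using finite_W assms finite_subset by blast
  show "x \<in> convex hull X"
    unfolding convex_hull_finite[OF \<open>finite X\<close>]
    using x 1 2 assms by (intro CollectI exI[of _ "\<lambda>c. coord c x"]) auto
qed

lemma affine_hull_minus:
  assumes c: "c \<in> C"
  shows "affine hull (C - {c}) = {x. coord c x = 0}"
proof
  show "affine hull (C - {c}) \<subseteq> {x. coord c x = 0}"
    using coord_at c by (intro hull_minimal affine_coord_zero) auto
  show "{x. coord c x = 0} \<subseteq> affine hull (C - {c})"
  proof clarify
    fix x assume x: "coord c x = 0"
    have "(\<Sum>c\<in>C. coord c x) = (\<Sum>c\<in>C-{c}. coord c x)"
      using x finite_W by (intro sum.mono_neutral_right) auto
    then have 1: "(\<Sum>c\<in>C-{c}. coord c x) = 1" using coord_sum[of x] by (simp add: coord_def)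
    have "(\<Sum>c\<in>C. coord c x *\<^sub>R c) = (\<Sum>c\<in>C-{c}. coord c x *\<^sub>R c)"
      using x finite_W by (intro sum.mono_neutral_right) auto
    then have 2: "(\<Sum>c\<in>C-{c}. coord c x *\<^sub>R c) = x" using coord_comb[of x] by (simp add: coord_def)
    show "x \<in> affine hull (C - {c})"
      using 1 2 finite_W by (subst affine_hull_finite) (auto intro!: exI[of _ "\<lambda>c. coord c x"])
  qed
qed

lemma aff_dim_minus:
  assumes "c \<in> C"
  shows "aff_dim (C - {c}) = DIM('a) - 1"
proof -
  have "{x. coord c x = 0} = {x. n c \<bullet> x = - b c}" by (auto simp: coord_def)
  then show ?thesis
    using aff_dim_hyperplane[OF n_nonzero[OF assms], of "- b c"] affine_hull_minus[OF assms]
      aff_dim_affine_hull[of "C - {c}"] by simp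
qed

lemma C_minus_a: "C - {a} = W"
  using a_notin by auto

lemma mem_base_iff: "x \<in> convex hull W \<longleftrightarrow> (\<forall>w\<in>W. 0 \<le> coord w x) \<and> coord a x = 0"
  unfolding mem_hull_iff[OF subset_insertI] using a_notin by auto

lemma mem_simplex_iff: "x \<in> convex hull C \<longleftrightarrow> (\<forall>c\<in>C. 0 \<le> coord c x)"
  using mem_hull_iff[of C x] by auto

text \<open>\<open>coord w\<close> is 0 at \<open>a\<close> and nonnegative at the neighbours of
  \<open>a\<close>, which form \<open>W\<close>, so its minimum on \<open>Q2\<close> is attained at
  \<open>a\<close>. Thus \<open>Q2\<close> lies in the cone from \<open>a\<close> over
  \<open>W\<close>.\<close>

lemma Q2_nonneg:
  assumes "x \<in> Q2" "w \<in> W"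
  shows "0 \<le> coord w x"
proof -
  have "n w \<bullet> a \<le> n w \<bullet> y" if "y \<in> neighbours Q2 a" for y
    using that nbrs coord_vertex[of w a] coord_vertex[of w y] assms(2) a_notin by (auto split: if_splits)
  then have "n w \<bullet> a \<le> n w \<bullet> x"
    using vertex_min_of_neighbours_min[OF polytope_Q2 a_vertex] assms(1) by blast
  then show ?thesis using coord_at[of w a] assms(2) a_notin by (auto simp: coord_def split: if_splits)
qed

lemma W_vertices: "W \<subseteq> vertices Q2 - {a}"
  using nbrs a_notin by (auto simp: neighbours_def)

lemma convex_Q2: "convex Q2" and convex_Q1: "convex Q1"
  using polytope_Q1 polytope_Q2 by (simp_all add: polytope_imp_convex)

lemma simplex_Q2: "convex hull C \<subseteq> Q2"
  using W_vertices a_vertex vertices_subset[of Q2] by (intro hull_minimal convex_Q2) auto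

lemma Q1_Q2: "Q1 \<subseteq> Q2"
  using Q1_simplex simplex_Q2 by blast

lemma R_Q2: "R \<subseteq> Q2"
  using vertices_subset[of Q2] by (intro hull_minimal convex_Q2) auto

lemma base_R: "convex hull W \<subseteq> R"
  using W_vertices by (rule hull_mono)

lemma base_Q1: "convex hull W \<subseteq> Q1"
  using base facet_of_imp_subset by blast

lemma Q2_pos: "x \<in> Q2 \<Longrightarrow> 0 \<le> coord a x \<Longrightarrow> x \<in> convex hull C"
  using Q2_nonneg mem_simplex_iff by blast

lemma Q2_zero: "x \<in> Q2 \<Longrightarrow> coord a x = 0 \<Longrightarrow> x \<in> convex hull W"
  using Q2_nonneg mem_base_iff by blast

lemma Q1_nonneg: "x \<in> Q1 \<Longrightarrow> c \<in> C \<Longrightarrow> 0 \<le> coord c x"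
  using Q1_simplex mem_simplex_iff by blast

text \<open>A vertex of \<open>Q2\<close> of positive height lies in the simplex and is extreme in
  it, so it is \<open>a\<close> or a point of \<open>W\<close>; but points of \<open>W\<close> have
  height 0.\<close>

lemma R_nonpos:
  assumes "x \<in> R"
  shows "coord a x \<le> 0"
proof -
  have "coord a v \<le> 0" if v: "v \<in> vertices Q2 - {a}" for v
  proof (rule ccontr)
    assume c: "\<not> coord a v \<le> 0"
    have vQ: "v \<in> Q2" using v vertices_subset by blast
    then have "v \<in> convex hull C" using c by (intro Q2_pos) auto
    then have "v extreme_point_of (convex hull C)"
      using v simplex_Q2 by (auto simp: vertices_def extreme_point_of_def)
    then have "v \<in> W" using extreme_point_of_convex_hull v by blast
    then show False using c v coord_at[of a v] by simp
  qed
  then have "vertices Q2 - {a} \<subseteq> {x. n a \<bullet> x \<le> - b a}"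
    unfolding coord_def by (smt (verit) mem_Collect_eq subsetI)
  then have "R \<subseteq> {x. n a \<bullet> x \<le> - b a}" by (intro hull_minimal convex_halfspace_le)
  then show ?thesis using assms by (auto simp: coord_def)
qed

text \<open>The simplex and \<open>R\<close> glue along \<open>convex hull W\<close> to a convex set
  that contains every vertex of \<open>Q2\<close>, hence all of \<open>Q2\<close>. Deleting the
  vertex \<open>a\<close> therefore cuts \<open>Q2\<close> exactly at height 0.\<close>

lemma mem_R_iff: "x \<in> R \<longleftrightarrow> x \<in> Q2 \<and> coord a x \<le> 0"
proof (intro iffI conjI)
  assume x: "x \<in> Q2 \<and> coord a x \<le> 0"
  have "convex (convex hull C \<union> R)"
  proof (rule convex_Un_crossing[where m="n a" and \<beta>="b a"])
    fix p q z assume pq: "p \<in> convex hull C" "q \<in> R" "z \<in> closed_segment p q" "n a \<bullet> z + b a = 0"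
    then have "z \<in> Q2"
      using closed_segment_subset[OF _ _ convex_Q2, of p q] simplex_Q2 R_Q2 by blast
    then have "z \<in> convex hull W" using pq(4) Q2_zero by (simp add: coord_def)
    then show "z \<in> convex hull C \<inter> R" using base_R hull_mono[of W C convex] by blast
  next
    fix y assume "y \<in> convex hull C" then show "0 \<le> n a \<bullet> y + b a"
      using mem_simplex_iff[of y] by (simp add: coord_def)
  next
    fix y assume "y \<in> R" then show "n a \<bullet> y + b a \<le> 0" using R_nonpos[of y] by (simp add: coord_def)
  qed simp_all
  moreover have "vertices Q2 \<subseteq> convex hull C \<union> R"
    using hull_subset[of C convex] hull_subset[of "vertices Q2 - {a}" convex] by blast
  ultimately have "Q2 \<subseteq> convex hull C \<union> R"
    using polytope_eq_hull_vertices[OF polytope_Q2] hull_minimal[of "vertices Q2" _ convex] by metis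
  then consider "x \<in> R" | "x \<in> convex hull C" using x by blast
  then show "x \<in> R"
  proof cases
    case 2
    then have "coord a x = 0" using x mem_simplex_iff[of x] by force
    then show ?thesis using Q2_zero base_R x by blast
  qed
qed (use R_Q2 R_nonpos in blast)+

lemma mem_M_pos: "0 \<le> coord a x \<Longrightarrow> x \<in> M \<longleftrightarrow> x \<in> Q1"
  using mem_R_iff[of x] Q2_zero[of x] base_Q1 by (force simp: M_def)

lemma mem_M_neg: "coord a x \<le> 0 \<Longrightarrow> x \<in> M \<longleftrightarrow> x \<in> Q2"
  using mem_R_iff[of x] Q1_Q2 by (auto simp: M_def)

lemma M_Q2: "M \<subseteq> Q2"
  using Q1_Q2 R_Q2 by (auto simp: M_def)

lemma Q1_M: "Q1 \<subseteq> M" by (simp add: M_def)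

lemma R_M: "R \<subseteq> M" by (simp add: M_def)

text \<open>A segment from \<open>Q1\<close> to \<open>R\<close> meets height 0 inside
  \<open>Q2\<close>, hence in \<open>convex hull W\<close>, which belongs to both pieces.\<close>

lemma convex_M: "convex M"
  unfolding M_def
proof (rule convex_Un_crossing[where m="n a" and \<beta>="b a"])
  fix p q z assume pq: "p \<in> Q1" "q \<in> R" "z \<in> closed_segment p q" "n a \<bullet> z + b a = 0"
  then have "z \<in> Q2"
    using closed_segment_subset[OF _ _ convex_Q2, of p q] Q1_Q2 R_Q2 by blast
  then have "z \<in> convex hull W" using pq(4) Q2_zero by (simp add: coord_def)
  then show "z \<in> Q1 \<inter> R" using base_R base_Q1 by blast
next
  fix y assume "y \<in> Q1" then show "0 \<le> n a \<bullet> y + b a"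
    using Q1_nonneg[of y a] by (simp add: coord_def)
next
  fix y assume "y \<in> R" then show "n a \<bullet> y + b a \<le> 0" using R_nonpos[of y] by (simp add: coord_def)
qed (simp_all add: convex_Q1)

lemma polytope_M: "polytope M"
proof -
  let ?V = "vertices Q1 \<union> (vertices Q2 - {a})"
  have "M = convex hull ?V"
  proof
    have "Q1 \<subseteq> convex hull ?V"
      using polytope_eq_hull_vertices[OF polytope_Q1] hull_mono[of "vertices Q1" ?V convex] by blast
    moreover have "R \<subseteq> convex hull ?V" by (intro hull_mono) blast
    ultimately show "M \<subseteq> convex hull ?V" by (simp add: M_def)
    show "convex hull ?V \<subseteq> M"
      using vertices_subset[of Q1] Q1_M hull_subset[of "vertices Q2 - {a}" convex] R_M
      by (intro hull_minimal convex_M) blast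
  qed
  moreover have "finite ?V" using finite_vertices polytope_Q1 polytope_Q2 by blast
  ultimately show ?thesis by (simp add: polytope_convex_hull)
qed

lemma aff_dim_base: "aff_dim (convex hull W) = DIM('a) - 1"
  using aff_dim_minus[of a] C_minus_a by (simp add: aff_dim_convex_hull)

lemma aff_dim_Q1: "aff_dim Q1 = DIM('a)"
  using base aff_dim_base by (simp add: facet_of_def)

lemma aff_dim_Q2: "aff_dim Q2 = DIM('a)"
  using aff_dim_subset[OF Q1_Q2] aff_dim_Q1 aff_dim_le_DIM[of Q2] by simp

lemma aff_dim_M: "aff_dim M = DIM('a)"
  using aff_dim_subset[OF Q1_M] aff_dim_Q1 aff_dim_le_DIM[of M] by simp

section \<open>Local agreement of the polytopes and simplicial faces\<close>

lemma open_pos: "open {x. 0 < coord a x}" and open_neg: "open {x. coord a x < 0}"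
proof -
  have "{x. 0 < coord a x} = {x. n a \<bullet> x > - b a}" "{x. coord a x < 0} = {x. n a \<bullet> x < - b a}"
    by (auto simp: coord_def)
  then show "open {x. 0 < coord a x}" "open {x. coord a x < 0}"
    by (simp_all add: open_halfspace_gt open_halfspace_lt)
qed

lemma M_local_pos: "M \<inter> {x. 0 < coord a x} = Q1 \<inter> {x. 0 < coord a x}"
  using mem_M_pos by force

lemma M_local_neg: "M \<inter> {x. coord a x < 0} = Q2 \<inter> {x. coord a x < 0}"
  using mem_M_neg by force

text \<open>A face without points of negative height is already a face of \<open>Q1\<close>.
  Otherwise it spans the face \<open>L\<close> of \<open>Q2\<close>; once \<open>a\<close> is
  excluded from \<open>L\<close>, all vertices of \<open>L\<close> lie in \<open>M\<close>, so
  \<open>L\<close> and \<open>K\<close> coincide.\<close>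

lemma simplex_face_M:
  assumes s1: "\<And>G. G face_of Q1 \<Longrightarrow> aff_dim G = k \<Longrightarrow> k simplex G"
    and s2: "\<And>G. G face_of Q2 \<Longrightarrow> aff_dim G = k \<Longrightarrow> k simplex G"
    and K: "K face_of M" "aff_dim K = k"
  shows "k simplex K"
proof (cases "\<exists>x\<in>K. coord a x < 0")
  case False
  have "K \<subseteq> Q1"
    using False mem_M_pos face_of_imp_subset[OF K(1)] by force
  then have "K face_of Q1" using face_of_subset[OF K(1) _ Q1_M] by blast
  then show ?thesis using s1 K(2) by blast
next
  case True
  then obtain x where x: "x \<in> K" "coord a x < 0" by blast
  then have ne: "K \<inter> {x. coord a x < 0} \<noteq> {}" by blast
  define L where "L = Q2 \<inter> affine hull K"
  have L: "L face_of Q2" "affine hull L = affine hull K"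
    using local_face[OF polytope_M convex_Q2 open_neg M_local_neg K(1) ne] by (simp_all add: L_def)
  have KL: "K \<subseteq> L"
    using face_of_imp_subset[OF K(1)] M_Q2 hull_subset[of K affine] by (auto simp: L_def)
  have "aff_dim L = k" using L(2) K(2) by (metis aff_dim_affine_hull)
  then have sL: "k simplex L" using s2 L(1) by blast
  \<comment> \<open>A simplex face through \<open>a\<close> would lie in \<Sigma>, where heights are
    nonnegative, although it contains \<open>x\<close>.\<close>
  have "a \<notin> L"
  proof
    assume "a \<in> L"
    then have "x \<in> convex hull C"
      using simplex_face_subset_hull_neighbours[OF L(1) sL a_vertex] KL x nbrs by blast
    then show False using x mem_simplex_iff by force
  qed
  then have "vertices L \<subseteq> vertices Q2 - {a}"
    using vertices_face[OF L(1)] by blast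
  then have "L \<subseteq> R"
    using polytope_eq_hull_vertices[OF face_of_polytope_polytope[OF polytope_Q2 L(1)]]
      hull_mono[of "vertices L" _ convex] by metis
  then have "L \<subseteq> M \<inter> affine hull K" using R_M by (auto simp: L_def)
  then have "L \<subseteq> K" using face_eq_Int_affine_hull[OF convex_M K(1)] by simp
  then show ?thesis using KL sL by simp
qed

end

section \<open>Facets through faces of the common facet, and simplicity\<close>

context merge_position
begin

text \<open>The hyperplane \<open>coord c = 0\<close> supports \<open>P\<close>, and the subset
  \<open>H\<close> witnesses that the supported face spans all of it.\<close>

lemma coordinate_facet:
  assumes P: "convex P" "aff_dim P = DIM('a)" and c: "c \<in> C"
    and nonneg: "\<And>x. x \<in> P \<Longrightarrow> 0 \<le> coord c x"
    and H: "H \<subseteq> P" "affine hull H = affine hull (C - {c})"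
  shows "(P \<inter> affine hull (C - {c})) facet_of P"
    and "affine hull (P \<inter> affine hull (C - {c})) = affine hull (C - {c})"
proof -
  let ?A = "affine hull (C - {c})"
  have "H \<subseteq> P \<inter> ?A" using H hull_subset[of H affine] by simp
  then have "?A \<subseteq> affine hull (P \<inter> ?A)" using H(2) hull_mono[of H _ affine] by metis
  moreover have "affine hull (P \<inter> ?A) \<subseteq> ?A" by (simp add: hull_minimal)
  ultimately show eq: "affine hull (P \<inter> ?A) = ?A" by simp
  then have dim: "aff_dim (P \<inter> ?A) = DIM('a) - 1"
    using aff_dim_minus[OF c] by (metis aff_dim_affine_hull)
  have "?A = {x. n c \<bullet> x = - b c}"
    unfolding affine_hull_minus[OF c] by (auto simp: coord_def)
  moreover have "n c \<bullet> x \<ge> - b c" if "x \<in> P" for x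
    using nonneg[OF that] by (simp add: coord_def)
  ultimately have "(P \<inter> ?A) face_of P"
    using face_of_Int_supporting_hyperplane_ge[OF P(1)] by simp
  moreover have "P \<inter> ?A \<noteq> {}" using dim DIM_positive[where 'a='a] by fastforce
  ultimately show "(P \<inter> ?A) facet_of P" using dim P(2) by (simp add: facet_of_def)
qed

lemma affine_hull_side:
  assumes "w \<in> W"
  shows "affine hull (Q1 \<inter> affine hull (C - {w})) = affine hull (C - {w})"
proof -
  have "aff_dim (affine hull (Q1 \<inter> affine hull (C - {w}))) = aff_dim (affine hull (C - {w}))"
    using side[OF assms] aff_dim_Q1 aff_dim_minus[of w] assms by (simp add: facet_of_def)
  moreover have "affine hull (Q1 \<inter> affine hull (C - {w})) \<subseteq> affine hull (C - {w})"
    by (simp add: hull_minimal)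
  moreover have "affine hull (Q1 \<inter> affine hull (C - {w})) \<noteq> {}"
    using side[OF assms] by (auto simp: facet_of_def)
  ultimately show ?thesis by (metis affine_dim_equal affine_affine_hull)
qed

lemma interior_coord_pos:
  assumes "p \<in> interior Q1" "c \<in> C"
  shows "0 < coord c p"
proof -
  have "interior Q1 \<subseteq> interior {x. n c \<bullet> x \<ge> - b c}"
    using Q1_nonneg[OF _ assms(2)] by (intro interior_mono) (force simp: coord_def)
  then show ?thesis
    using assms(1) n_nonzero[OF assms(2)] by (auto simp: coord_def)
qed

lemma interior_Q1_ne: "interior Q1 \<noteq> {}"
proof -
  have "rel_interior Q1 = interior Q1" using interior_rel_interior_gen[of Q1] aff_dim_Q1 by simp
  moreover have "Q1 \<noteq> {}" using aff_dim_Q1 DIM_positive[where 'a='a] by fastforce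
  ultimately show ?thesis using rel_interior_eq_empty[OF convex_Q1] by simp
qed

text \<open>The assumption on the facets makes \<open>Q1\<close> agree with the simplex near the relative interior
  of \<open>K\<close>, so a functional that supports \<open>M\<close> in \<open>K\<close> is also strictly on the right side at \<open>a\<close>.\<close>
lemma base_face_of_Q2:
  assumes K: "K face_of M" "K \<noteq> {}" "\<And>x. x \<in> K \<Longrightarrow> coord a x = 0"
    and facets: "\<And>G. G facet_of Q1 \<Longrightarrow> K \<subseteq> G \<Longrightarrow> \<exists>c\<in>C. G \<subseteq> affine hull (C - {c})"
  shows "K face_of Q2"
proof -
  have KQ1: "K \<subseteq> Q1" using K mem_M_pos face_of_imp_subset[OF K(1)] by force
  obtain x where x: "x \<in> rel_interior K"
    using rel_interior_eq_empty[OF face_of_imp_convex[OF K(1)]] K(2) by blast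
  then have xK: "x \<in> K" using rel_interior_subset by blast
  obtain p where p: "p \<in> interior Q1" using interior_Q1_ne by blast
  have sep: "affine hull G \<inter> open_segment p a = {}" if G: "G facet_of Q1" "x \<in> G" for G
  proof -
    \<comment> \<open>As \<open>x\<close> is relatively interior to \<open>K\<close>, a facet
      through \<open>x\<close> contains all of \<open>K\<close>, so \<open>facets\<close> applies to
      it.\<close>
    have "K \<subseteq> G"
      using subset_of_face_of[OF facet_of_imp_face_of[OF G(1)] KQ1] G(2) x by blast
    then obtain c where c: "c \<in> C" "G \<subseteq> affine hull (C - {c})" using facets G(1) by blast
    then have "G \<subseteq> {z. coord c z = 0}" using affine_hull_minus[OF c(1)] by simp
    then have "affine hull G \<subseteq> {z. coord c z = 0}" by (intro hull_minimal affine_coord_zero)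
    moreover have "0 < coord c z" if z: "z \<in> open_segment p a" for z
    proof -
      obtain t where t: "0 < t" "t < 1" "z = (1 - t) *\<^sub>R p + t *\<^sub>R a"
        using z by (auto simp: in_segment)
      have "0 < (1 - t) * coord c p" using t interior_coord_pos[OF p c(1)] by simp
      moreover have "0 \<le> t * coord c a" using t coord_at[OF c(1), of a] by simp
      ultimately show ?thesis unfolding t(3) coord_convex_comb by linarith
    qed
    ultimately show ?thesis by fastforce
  qed
  \<comment> \<open>No hyperplane of a facet through \<open>x\<close> separates \<open>p\<close>
    from \<open>a\<close>, so \<open>Q1\<close> contains a short step from \<open>x\<close> towards
    \<open>a\<close>.\<close>
  obtain e where e: "0 < e" "x + e *\<^sub>R (a - x) \<in> Q1"
    using feasible_direction[OF polytope_Q1 p _ sep] xK KQ1 by blast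
  let ?y = "x + e *\<^sub>R (a - x)"
  obtain m \<beta> where m: "M \<subseteq> {z. m \<bullet> z \<le> \<beta>}" "K = M \<inter> {z. m \<bullet> z = \<beta>}"
    using K(1) exposed_face_of_polyhedron[OF polytope_imp_polyhedron[OF polytope_M], of K]
    by (auto simp: exposed_face_of_def)
  \<comment> \<open>The step has positive height and so leaves \<open>K\<close>; the strict
    inequality for \<open>m\<close> there extends along the ray to \<open>a\<close>.\<close>
  have "coord a ?y = e" using K(3)[OF xK] coord_at[of a a] by (simp add: coord_step)
  then have "?y \<notin> K" using K(3) e(1) by force
  then have "m \<bullet> ?y < \<beta>" using m e(2) Q1_M by force
  moreover have "m \<bullet> x = \<beta>" using m xK by blast
  ultimately have "e * (m \<bullet> a - \<beta>) < 0" by (simp add: inner_add inner_diff)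
  then have ma: "m \<bullet> a < \<beta>" using e(1) by (simp add: mult_less_0_iff)
  have "v \<in> M" if "v \<in> vertices Q2 - {a}" for v
    using that R_M hull_inc[of v "vertices Q2 - {a}" convex] by blast
  then have "vertices Q2 \<subseteq> {z. m \<bullet> z \<le> \<beta>}" using m(1) ma by force
  then have "convex hull (vertices Q2) \<subseteq> {z. m \<bullet> z \<le> \<beta>}"
    by (intro hull_minimal convex_halfspace_le)
  then have Q2_le: "Q2 \<subseteq> {z. m \<bullet> z \<le> \<beta>}"
    by (subst polytope_eq_hull_vertices[OF polytope_Q2])
  define E where "E = Q2 \<inter> {z. m \<bullet> z = \<beta>}"
  have E: "E face_of Q2"
    unfolding E_def using face_of_Int_supporting_hyperplane_le[OF convex_Q2] Q2_le by blast
  \<comment> \<open>Since \<open>a\<close> satisfies the inequality strictly, \<open>E\<close> has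
    only vertices kept in \<open>R\<close>. Hence it lies in \<open>M\<close> and equals
    \<open>K\<close>.\<close>
  have "vertices E \<subseteq> vertices Q2 - {a}"
    using vertices_face[OF E] ma by (auto simp: E_def)
  then have "E \<subseteq> R"
    using polytope_eq_hull_vertices[OF face_of_polytope_polytope[OF polytope_Q2 E]]
      hull_mono[of "vertices E" _ convex] by metis
  then have "E = K" using R_M M_Q2 m(2) by (auto simp: E_def)
  then show ?thesis using E by simp
qed

lemma zero_on_segment:
  assumes "0 < coord a p" "coord a y < 0"
  obtains z where "z \<in> open_segment p y" "coord a z = 0"
proof -
  define t where "t = coord a p / (coord a p - coord a y)"
  have t: "0 < t" "t < 1" using assms by (auto simp: t_def field_simps)
  have "t * (coord a p - coord a y) = coord a p" using assms by (simp add: t_def)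
  then have "coord a ((1 - t) *\<^sub>R p + t *\<^sub>R y) = 0"
    unfolding coord_convex_comb by (simp add: algebra_simps)
  moreover have "p \<noteq> y" using assms by auto
  ultimately show ?thesis using that[of "(1 - t) *\<^sub>R p + t *\<^sub>R y"] t by (auto simp: in_segment)
qed

text \<open>A segment from \<open>p\<close> to a point of negative height would cross height 0
  within \<open>Q2\<close>, thus in \<open>convex hull W\<close>. Being a face, that set would
  absorb the endpoint \<open>p\<close>, whose height is positive.\<close>

lemma base_face_imp_nonneg:
  assumes base_face: "(convex hull W) face_of P" and P: "convex P" "P \<subseteq> Q2"
    and p: "p \<in> P" "0 < coord a p" and x: "x \<in> P"
  shows "0 \<le> coord a x"
proof (rule ccontr)
  assume "\<not> 0 \<le> coord a x"
  then obtain z where z: "z \<in> open_segment p x" "coord a z = 0"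
    using zero_on_segment[OF p(2), of x] by auto
  then have "z \<in> P" using P(1) p(1) x closed_segment_subset open_closed_segment by blast
  then have "z \<in> convex hull W" using z(2) Q2_zero P(2) by blast
  then have "p \<in> convex hull W" using face_ofD[OF base_face z(1) p(1) x] by blast
  then show False using p(2) mem_base_iff by simp
qed

text \<open>A facet reaching below height 0 is handled locally. Any other one is a facet of
  \<open>Q1\<close>, so \<open>sides\<close> puts it in a hyperplane \<open>coord c = 0\<close>,
  which also supports \<open>Q2\<close>. Keeping the affine hull makes the passage from
  \<open>M\<close> to \<open>Q2\<close> reversible.\<close>

lemma facet_M_imp_facet_Q2:
  assumes G: "G facet_of M"
    and sides: "\<And>G. G facet_of Q1 \<Longrightarrow> K \<subseteq> G \<Longrightarrow> \<exists>c\<in>C. G \<subseteq> affine hull (C - {c})" and "K \<subseteq> G"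
  shows "(Q2 \<inter> affine hull G) facet_of Q2 \<and> affine hull (Q2 \<inter> affine hull G) = affine hull G"
proof (cases "\<exists>x\<in>G. coord a x < 0")
  case True
  then have ne: "G \<inter> {x. coord a x < 0} \<noteq> {}" by blast
  show ?thesis
    using local_facet[OF polytope_M convex_Q2 open_neg M_local_neg G ne]
      local_face(2)[OF polytope_M convex_Q2 open_neg M_local_neg facet_of_imp_face_of[OF G] ne] by blast
next
  case False
  have GM: "G face_of M" "G \<subseteq> M" using G facet_of_imp_face_of facet_of_imp_subset by blast+
  then have GQ1: "G \<subseteq> Q1" using False mem_M_pos by force
  then have "G face_of Q1" using face_of_subset[OF GM(1) _ Q1_M] by blast
  then have GQ: "G facet_of Q1" using G aff_dim_M aff_dim_Q1 by (simp add: facet_of_def)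
  then obtain c where c: "c \<in> C" "G \<subseteq> affine hull (C - {c})" using sides assms(3) by blast
  have aff: "affine hull G = affine hull (C - {c})"
  proof -
    have "aff_dim (affine hull G) = aff_dim (affine hull (C - {c}))"
      using GQ aff_dim_Q1 aff_dim_minus[OF c(1)] by (simp add: facet_of_def)
    moreover have "affine hull G \<subseteq> affine hull (C - {c})"
      using c(2) by (simp add: hull_minimal)
    moreover have "affine hull G \<noteq> {}" using G by (auto simp: facet_of_def)
    ultimately show ?thesis by (metis affine_dim_equal affine_affine_hull)
  qed
  have nonneg: "0 \<le> coord c x" if "x \<in> Q2" for x
  proof (cases "c = a")
    \<comment> \<open>Here \<open>G\<close> is \<open>convex hull W\<close> itself. As this is a
      face of \<open>M\<close>, and \<open>M\<close> has points of positive height, \<open>M\<close>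
      has no point of negative height; neither has \<open>Q2\<close>, which agrees with
      \<open>M\<close> there.\<close>
    case True
    have "G \<subseteq> convex hull W"
    proof
      fix y assume "y \<in> G"
      then show "y \<in> convex hull W"
        using Q2_zero[of y] GM(2) M_Q2 c(2) affine_hull_minus[OF c(1)] True by blast
    qed
    moreover have "convex hull W \<subseteq> affine hull G"
      using aff True C_minus_a convex_hull_subset_affine_hull[of W] by simp
    ultimately have "(convex hull W) face_of M"
      using face_eq_Int_affine_hull[OF convex_M GM(1)] GM(1) base_Q1 Q1_M by (metis Int_greatest order_antisym order_trans)
    moreover obtain p where "p \<in> interior Q1" using interior_Q1_ne by blast
    then have "p \<in> M" "0 < coord a p"
      using interior_coord_pos[of p a] interior_subset[of Q1] Q1_M by auto
    ultimately have "0 \<le> coord a y" if "y \<in> M" for y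
      using base_face_imp_nonneg[OF _ convex_M M_Q2] that by blast
    then show ?thesis using mem_M_neg[of x] \<open>x \<in> Q2\<close> True by force
  qed (use Q2_nonneg c that in blast)
  show ?thesis
    using coordinate_facet[OF convex_Q2 aff_dim_Q2 c(1) nonneg, of G] aff GM M_Q2 by auto
qed

text \<open>A facet of \<open>Q2\<close> without points of negative height lies in \<Sigma> and is
  one of its facets, so it spans \<open>coord c = 0\<close> for some \<open>c\<close>. In
  \<open>M\<close> this hyperplane is spanned by the base if \<open>c = a\<close> and by a side
  facet of \<open>Q1\<close> otherwise.\<close>

lemma facet_Q2_imp_facet_M:
  assumes G: "G facet_of Q2"
  shows "(M \<inter> affine hull G) facet_of M \<and> affine hull (M \<inter> affine hull G) = affine hull G"
proof (cases "\<exists>x\<in>G. coord a x < 0")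
  case True
  then have ne: "G \<inter> {x. coord a x < 0} \<noteq> {}" by blast
  show ?thesis
    using local_facet[OF polytope_Q2 convex_M open_neg M_local_neg[symmetric] G ne]
      local_face(2)[OF polytope_Q2 convex_M open_neg M_local_neg[symmetric] facet_of_imp_face_of[OF G] ne] by blast
next
  case False
  have GQ: "G face_of Q2" "G \<subseteq> Q2" using G facet_of_imp_face_of facet_of_imp_subset by blast+
  have GS: "G \<subseteq> convex hull C" using False Q2_pos GQ by force
  have "aff_dim (convex hull C) = DIM('a)"
    using aff_dim_affine_independent[OF indep] card_W a_notin finite_W by (simp add: aff_dim_convex_hull)
  then have "G facet_of (convex hull C)"
    using face_of_subset[OF GQ(1) GS simplex_Q2] G aff_dim_Q2 by (simp add: facet_of_def)
  then obtain c where c: "c \<in> C" "G = convex hull (C - {c})"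
    using facet_of_convex_hull_affine_independent[OF indep] by blast
  have aff: "affine hull G = affine hull (C - {c})" using c(2) by simp
  show ?thesis
  proof (cases "c = a")
    case True
    then have "(convex hull W) face_of Q2" using GQ c(2) C_minus_a by simp
    moreover have "a \<in> Q2" "0 < coord a a" using a_vertex vertices_subset[of Q2] coord_at[of a a] by auto
    ultimately have nonneg: "0 \<le> coord a x" if "x \<in> M" for x
      using base_face_imp_nonneg[OF _ convex_Q2] M_Q2 that by blast
    show ?thesis
      using coordinate_facet[OF convex_M aff_dim_M, of a "convex hull W"] nonneg base_Q1 Q1_M True
        C_minus_a aff by auto
  next
    case False
    then have "c \<in> W" using c by blast
    then have nonneg: "0 \<le> coord c x" if "x \<in> M" for x using Q2_nonneg M_Q2 that by blast
    show ?thesis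
      using coordinate_facet[OF convex_M aff_dim_M c(1) nonneg, of "Q1 \<inter> affine hull (C - {c})"]
        affine_hull_side[OF \<open>c \<in> W\<close>] Q1_M aff by auto
  qed
qed

text \<open>The base and the side facets for \<open>w\<close> in \<open>W - X\<close> all contain
  \<open>convex hull X\<close>. They already number \<open>DIM('a) - card X + 1\<close>, so
  \<open>card\<close> leaves no room for other facets.\<close>

lemma facets_of_Q1_over_base_face:
  assumes X: "X \<subseteq> W" and card: "card {G. G facet_of Q1 \<and> convex hull X \<subseteq> G} = DIM('a) - card X + 1"
    and G: "G facet_of Q1" "convex hull X \<subseteq> G"
  shows "\<exists>c\<in>C. G \<subseteq> affine hull (C - {c})"
proof -
  let ?H = "\<lambda>w. Q1 \<inter> affine hull (C - {w})"
  let ?F = "{G. G facet_of Q1 \<and> convex hull X \<subseteq> G}"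
  let ?N = "insert (convex hull W) (?H ` (W - X))"
  \<comment> \<open>The side facet for \<open>w\<close> contains every point of \<open>W\<close>
    except \<open>w\<close>, which distinguishes the side facets from each other and from the
    base.\<close>
  have in_H: "w' \<in> ?H w \<longleftrightarrow> w' \<noteq> w" if "w \<in> W" "w' \<in> W" for w w'
    using that affine_hull_minus[of w] coord_at[of w w'] base_Q1 hull_inc[of w' W convex] by auto
  have "?N \<subseteq> ?F"
  proof -
    have "convex hull X \<subseteq> ?H w" if w: "w \<in> W - X" for w
    proof -
      have "X \<subseteq> C - {w}" using w X by blast
      then have "convex hull X \<subseteq> affine hull (C - {w})"
        using convex_hull_subset_affine_hull[of X] hull_mono[of X "C - {w}" affine] by blast
      moreover have "convex hull X \<subseteq> Q1" using hull_mono[OF X, of convex] base_Q1 by blast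
      ultimately show ?thesis by blast
    qed
    then show ?thesis using base side hull_mono[OF X, of convex] by auto
  qed
  moreover have "finite ?F" using finite_polytope_facets[OF polytope_Q1] by (rule rev_finite_subset) blast
  moreover have "card ?N = card ?F"
  proof -
    have "inj_on ?H (W - X)" using in_H by (intro inj_onI) (metis DiffD1)
    then have "card (?H ` (W - X)) = DIM('a) - card X"
      using card_Diff_subset[OF finite_subset[OF X finite_W] X] card_W by (simp add: card_image)
    moreover have "convex hull W \<notin> ?H ` (W - X)" using in_H hull_inc[of _ W convex] by blast
    ultimately show ?thesis using card finite_W by simp
  qed
  ultimately have "?N = ?F" by (intro card_subset_eq)
  then consider "G = convex hull W" | w where "w \<in> W" "G = ?H w" using G by blast
  then show ?thesis
  proof cases
    case 1
    then have "G \<subseteq> affine hull (C - {a})" using convex_hull_subset_affine_hull[of W] C_minus_a by simp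
    then show ?thesis by blast
  qed blast
qed

lemma facet_count_M:
  assumes s1: "\<And>G. G face_of Q1 \<Longrightarrow> aff_dim G = int DIM('a) - int i - 1 \<Longrightarrow> card {H. H facet_of Q1 \<and> G \<subseteq> H} = i + 1"
    and s2: "\<And>G. G face_of Q2 \<Longrightarrow> aff_dim G = int DIM('a) - int i - 1 \<Longrightarrow> card {H. H facet_of Q2 \<and> G \<subseteq> H} = i + 1"
    and i: "i < DIM('a)"
    and K: "K face_of M" "aff_dim K = int DIM('a) - int i - 1"
  shows "card {H. H facet_of M \<and> K \<subseteq> H} = i + 1"
proof -
  consider "K \<inter> {x. 0 < coord a x} \<noteq> {}" | "K \<inter> {x. coord a x < 0} \<noteq> {}"
    | "\<And>x. x \<in> K \<Longrightarrow> coord a x = 0" by force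
  then show ?thesis
  proof cases
    case 1
    have "(Q1 \<inter> affine hull K) face_of Q1" "aff_dim (Q1 \<inter> affine hull K) = aff_dim K"
      using local_face[OF polytope_M convex_Q1 open_pos M_local_pos K(1) 1] by (auto intro: aff_dim_affine_hull2)
    then show ?thesis
      using local_facet_card[OF polytope_M polytope_Q1 open_pos M_local_pos K(1) 1] s1 K(2) by simp
  next
    case 2
    have "(Q2 \<inter> affine hull K) face_of Q2" "aff_dim (Q2 \<inter> affine hull K) = aff_dim K"
      using local_face[OF polytope_M convex_Q2 open_neg M_local_neg K(1) 2] by (auto intro: aff_dim_affine_hull2)
    then show ?thesis
      using local_facet_card[OF polytope_M polytope_Q2 open_neg M_local_neg K(1) 2] s2 K(2) by simp
  next
    case 3
    have K_ne: "K \<noteq> {}" using K(2) i by auto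
    have KQ1: "K \<subseteq> Q1" using 3 mem_M_pos face_of_imp_subset[OF K(1)] by force
    then have K1: "K face_of Q1" using face_of_subset[OF K(1) _ Q1_M] by blast
    have KW: "K \<subseteq> convex hull W" using 3 KQ1 Q1_Q2 Q2_zero by blast
    have indep_W: "\<not> affine_dependent W" using indep affine_dependent_subset by blast
    have "K face_of (convex hull W)" using face_of_subset[OF K1 KW base_Q1] .
    then obtain X where X: "X \<subseteq> W" "K = convex hull X"
      using face_of_convex_hull_affine_independent[OF indep_W] by auto
    have "\<not> affine_dependent X" using indep_W X(1) affine_dependent_subset by blast
    then have "aff_dim K = int (card X) - 1"
      using X(2) aff_dim_affine_independent[of X] by (simp add: aff_dim_convex_hull)
    \<comment> \<open>Here \<open>card X = DIM('a) - i\<close>, so the \<open>i + 1\<close> facets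
      of \<open>Q1\<close> through \<open>K\<close> are exactly the base and the side
      facets.\<close>
    then have "DIM('a) - card X + 1 = i + 1" using K(2) i by linarith
    then have sides: "\<exists>c\<in>C. G \<subseteq> affine hull (C - {c})" if "G facet_of Q1" "K \<subseteq> G" for G
      using facets_of_Q1_over_base_face[OF X(1)] s1[OF K1 K(2)] that X(2) by simp
    have K2: "K face_of Q2" using base_face_of_Q2[OF K(1) K_ne 3 sides] by blast
    \<comment> \<open>Facets of \<open>M\<close> and \<open>Q2\<close> through \<open>K\<close> are
      matched by their affine hulls, as in the local count.\<close>
    have "card {H. H facet_of M \<and> K \<subseteq> H} = card {H. H facet_of Q2 \<and> K \<subseteq> H}"
    proof (rule bij_betw_same_card, rule bij_betwI[where g="\<lambda>G. M \<inter> affine hull G"])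
      have sub: "K \<subseteq> P \<inter> affine hull G" if "K \<subseteq> P" "K \<subseteq> G" for P G
        using that hull_subset[of G affine] by blast
      have a: "(Q2 \<inter> affine hull G) facet_of Q2 \<and> affine hull (Q2 \<inter> affine hull G) = affine hull G"
        if "G facet_of M" "K \<subseteq> G" for G
        using facet_M_imp_facet_Q2[OF that(1) sides that(2)] .
      show "(\<lambda>G. Q2 \<inter> affine hull G) \<in> {H. H facet_of M \<and> K \<subseteq> H} \<rightarrow> {H. H facet_of Q2 \<and> K \<subseteq> H}"
      proof (rule Pi_I)
        fix G assume "G \<in> {H. H facet_of M \<and> K \<subseteq> H}"
        then have G: "G facet_of M" "K \<subseteq> G" by simp_all
        then show "Q2 \<inter> affine hull G \<in> {H. H facet_of Q2 \<and> K \<subseteq> H}"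
          using conjunct1[OF a[OF G]] sub[OF order_trans[OF KQ1 Q1_Q2] G(2)] by blast
      qed
      show "(\<lambda>G. M \<inter> affine hull G) \<in> {H. H facet_of Q2 \<and> K \<subseteq> H} \<rightarrow> {H. H facet_of M \<and> K \<subseteq> H}"
      proof (rule Pi_I)
        fix G assume "G \<in> {H. H facet_of Q2 \<and> K \<subseteq> H}"
        then have G: "G facet_of Q2" "K \<subseteq> G" by simp_all
        then show "M \<inter> affine hull G \<in> {H. H facet_of M \<and> K \<subseteq> H}"
          using conjunct1[OF facet_Q2_imp_facet_M[OF G(1)]] sub[OF order_trans[OF KQ1 Q1_M] G(2)] by blast
      qed
      show "M \<inter> affine hull (Q2 \<inter> affine hull G) = G" if "G \<in> {H. H facet_of M \<and> K \<subseteq> H}" for G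
        using that a[of G] face_eq_Int_affine_hull[OF convex_M facet_of_imp_face_of, of G] by simp
      show "Q2 \<inter> affine hull (M \<inter> affine hull G) = G" if "G \<in> {H. H facet_of Q2 \<and> K \<subseteq> H}" for G
        using that facet_Q2_imp_facet_M[of G] face_eq_Int_affine_hull[OF convex_Q2 facet_of_imp_face_of, of G]
        by simp
    qed
    then show ?thesis using s2[OF K2 K(2)] by simp
  qed
qed

lemma d_polytope_M: "d_polytope DIM('a) M"
  using polytope_M aff_dim_M by (simp add: d_polytope_def)

lemma j_simplicial_M:
  assumes "j_simplicial DIM('a) j Q1" "j_simplicial DIM('a) j Q2"
  shows "j_simplicial DIM('a) j M"
  unfolding j_simplicial_def
proof (intro conjI allI impI)
  fix K assume K: "K face_of M \<and> aff_dim K = int j"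
  show "int j simplex K"
    by (rule simplex_face_M) (use assms K in \<open>simp_all add: j_simplicial_def\<close>)
qed (rule d_polytope_M)

lemma i_simple_M:
  assumes "i_simple DIM('a) i Q1" "i_simple DIM('a) i Q2" "i < DIM('a)"
  shows "i_simple DIM('a) i M"
  unfolding i_simple_def
proof (intro conjI allI impI)
  fix K assume K: "K face_of M \<and> aff_dim K = int DIM('a) - int i - 1"
  show "card {H. H facet_of M \<and> K \<subseteq> H} = i + 1"
    by (rule facet_count_M) (use assms K in \<open>simp_all add: i_simple_def\<close>)
qed (rule d_polytope_M)

end

section \<open>Reduction of a merge to normal position\<close>

theorem theorem4p6:
  fixes P1 P2 F M :: "'a::euclidean_space set"
    and v :: 'a
    and u u' :: "nat \<Rightarrow> 'a"
    and d i j :: nat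
  assumes "DIM('a) = d" and "d \<ge> 2"
    and "1 \<le> i" and "i \<le> d - 1" and "1 \<le> j" and "j \<le> d - 1"
    and "d_polytope d P1" and "d_polytope d P2"
    and "simplex_facet d P1 F" and "bij_betw u {1..d} (vertices F)"
    and "simple_vertex d P2 v" and "bij_betw u' {1..d} (neighbours P2 v)"
    and "is_merge d P1 F u P2 v u' M"
  shows "(j_simplicial d j P1 \<and> j_simplicial d j P2 \<longrightarrow> j_simplicial d j M) \<and>
         (i_simple d i P1 \<and> i_simple d i P2 \<longrightarrow> i_simple d i M)"
proof -
  note dim = assms(1)
  have P1: "polytope P1" "convex P1" and P2: "polytope P2" "convex P2"
    using assms(7,8) by (auto simp: d_polytope_def polytope_imp_convex)
  have F: "F facet_of P1" using assms(9) by (simp add: simplex_facet_def)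
  then have FP: "F \<subseteq> P1" "polytope F"
    using facet_of_imp_subset face_of_polytope_polytope[OF P1(1) facet_of_imp_face_of] by blast+
  have Vu: "u ` {1..d} = vertices F" and Vu': "u' ` {1..d} = neighbours P2 v"
    using assms(10,12) by (simp_all add: bij_betw_def)
  have v: "v \<in> vertices P2" using assms(11) by (simp add: simple_vertex_def)
  obtain H f \<Sigma> a g where
    H: "\<forall>j\<in>{1..d}. H j facet_of P1 \<and> H j \<inter> F = convex hull (u ` ({1..d} - {j}))"
    and f: "projective_on P1 f" and \<Sigma>: "int d simplex \<Sigma>"
    and hyp: "{affine hull G |G. G facet_of \<Sigma>} =
          insert (affine hull (f ` F)) ((\<lambda>j. affine hull (f ` H j)) ` {1..d})"
    and P1\<Sigma>: "f ` P1 \<subseteq> \<Sigma>" and a: "a \<in> vertices \<Sigma>" "a \<notin> f ` F"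
    and g: "affine_map g" "g v = a" "\<forall>k\<in>{1..d}. g (u' k) = f (u k)"
    and M: "M = f ` P1 \<union> convex hull (vertices (g ` P2) - {g v})"
    using assms(13) unfolding is_merge_def by (elim exE conjE)
  obtain T s where "projective_map P1 f T s"
    using projective_on_imp_projective_map[OF f P1(2)] .
  then interpret pf: projective_map P1 f T s .
  define W where "W = f ` u ` {1..d}"
  have W: "W = f ` vertices F" unfolding W_def Vu ..
  have VF: "vertices F \<subseteq> P1" using vertices_subset[of F] FP by blast
  have hullW: "convex hull W = f ` F"
    unfolding W pf.image_convex_hull[OF VF, symmetric] polytope_eq_hull_vertices[OF FP(2), symmetric] ..
  have "card W = card (vertices F)"
    unfolding W using inj_on_subset[OF pf.inj VF] by (rule card_image)
  then have cardW: "card W = DIM('a)" using bij_betw_same_card[OF assms(10)] dim by simp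
  have a_W: "a \<notin> W" using a(2) hullW hull_inc[of a W convex] by blast
  obtain D where D: "\<not> affine_dependent D" "card D = DIM('a) + 1" "\<Sigma> = convex hull D"
    using \<Sigma> dim by (auto simp: simplex_def)
  have finD: "finite D" using D(1) aff_independent_finite by blast
  obtain n b where nb: "\<And>c c'. c \<in> D \<Longrightarrow> c' \<in> D \<Longrightarrow> n c \<bullet> c' + b c = (if c' = c then 1 else 0)"
    "\<And>x. (\<Sum>c\<in>D. n c \<bullet> x + b c) = (1::real)" "\<And>x. (\<Sum>c\<in>D. (n c \<bullet> x + b c) *\<^sub>R c) = x"
    by (rule barycentric_functionals[OF D(1,2)], rule that, assumption+)
  define A where "A c = affine hull (D - {c})" for c
  have A_zero: "n c \<bullet> x + b c = 0" if "c \<in> D" "x \<in> A c" for c x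
  proof -
    have "A c \<subseteq> {x. n c \<bullet> x = - b c}"
      unfolding A_def using nb(1)[OF that(1)]
      by (intro hull_minimal affine_hyperplane) (force simp: add_eq_0_iff2)
    then show ?thesis using that(2) by auto
  qed
  have "{affine hull G |G. G facet_of \<Sigma>} = A ` D"
  proof -
    have "G facet_of \<Sigma> \<longleftrightarrow> (\<exists>c\<in>D. G = convex hull (D - {c}))" for G
    proof -
      have "convex hull (D - {c}) \<noteq> {}" if "c \<in> D" for c
      proof -
        have "card (D - {c}) > 0" using that D(2) finD DIM_positive[where 'a='a] by simp
        then have "D - {c} \<noteq> {}" by (metis card.empty less_irrefl)
        then show ?thesis by simp
      qed
      then show ?thesis
        unfolding D(3) facet_of_convex_hull_affine_independent[OF D(1)] by blast
    qed
    then have "{G. G facet_of \<Sigma>} = (\<lambda>c. convex hull (D - {c})) ` D" by blast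
    moreover have "{affine hull G |G. G facet_of \<Sigma>} = (\<lambda>G. affine hull G) ` {G. G facet_of \<Sigma>}" by blast
    ultimately show ?thesis by (simp add: image_image A_def)
  qed
  \<comment> \<open>Index 0 stands for \<open>F\<close> and index \<open>k\<close> from 1 to
    \<open>d\<close> for \<open>H k\<close>, so that the \<open>d + 1\<close> hyperplanes form one
    family.\<close>
  moreover define B where "B k = (if k = 0 then affine hull (f ` F) else affine hull (f ` H k))" for k
  have "insert (affine hull (f ` F)) ((\<lambda>j. affine hull (f ` H j)) ` {1..d}) = B ` {0..d}"
  proof -
    have "{0..d} = insert 0 {1..d}" by auto
    moreover have "B ` {1..d} = (\<lambda>j. affine hull (f ` H j)) ` {1..d}"
      by (intro image_cong) (auto simp: B_def)
    moreover have "B 0 = affine hull (f ` F)" by (simp add: B_def)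
    ultimately show ?thesis by (simp only: image_insert)
  qed
  ultimately have BA: "B ` {0..d} = A ` D" using hyp by simp
  have "inj_on A D"
  proof (rule inj_onI, rule ccontr)
    fix c c' assume c: "c \<in> D" "c' \<in> D" "A c = A c'" "c \<noteq> c'"
    then have "c \<in> A c'" unfolding A_def by (intro hull_inc) simp
    then show False using A_zero[OF c(1)] nb(1)[OF c(1,1)] c(3) by simp
  qed
  \<comment> \<open>\<open>hyp\<close> only equates sets of hyperplanes. Since the simplex has
    \<open>d + 1\<close> distinct facet hyperplanes, the \<open>B k\<close> must be pairwise
    distinct.\<close>
  then have "card (B ` {0..d}) = card {0..d}" using BA D(2) dim by (simp add: card_image)
  then have injB: "inj_on B {0..d}" by (intro eq_card_imp_inj_on) simp
  \<comment> \<open>The vertex of \<Sigma> opposite the hyperplane \<open>B k\<close>.\<close>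
  define \<sigma> where "\<sigma> k = inv_into D A (B k)" for k
  have \<sigma>: "\<sigma> k \<in> D" "A (\<sigma> k) = B k" if "k \<in> {0..d}" for k
  proof -
    have "B k \<in> A ` D" using that BA by blast
    then show "\<sigma> k \<in> D" "A (\<sigma> k) = B k"
      unfolding \<sigma>_def by (rule inv_into_into, rule f_inv_into_f)
  qed
  have inj\<sigma>: "inj_on \<sigma> {0..d}"
    using \<sigma>(2) injB by (metis inj_onI inj_onD)
  have D\<sigma>: "D = \<sigma> ` {0..d}"
  proof (rule card_subset_eq[OF finD, symmetric])
    show "\<sigma> ` {0..d} \<subseteq> D" using \<sigma>(1) by blast
    show "card (\<sigma> ` {0..d}) = card D" using inj\<sigma> D(2) dim by (simp add: card_image)
  qed
  \<comment> \<open>\<open>u k\<close> lies in \<open>F\<close> and in every \<open>H l\<close> with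
    \<open>l\<close> different from \<open>k\<close>. So all barycentric coordinates of its image
    vanish except the one at \<open>\<sigma> k\<close>, which is then 1.\<close>
  have fu: "f (u k) = \<sigma> k" if k: "k \<in> {1..d}" for k
  proof -
    have uF: "u k \<in> F" using k Vu vertices_subset[of F] by blast
    have zero: "n c \<bullet> f (u k) + b c = 0" if c: "c \<in> D - {\<sigma> k}" for c
    proof -
      obtain l where l: "l \<in> {0..d}" "c = \<sigma> l" "l \<noteq> k" using c D\<sigma> by blast
      have "f (u k) \<in> B l"
      proof (cases "l = 0")
        case True
        then show ?thesis using uF by (simp add: B_def hull_inc)
      next
        case False
        then have l1: "l \<in> {1..d}" using l by simp
        have "u k \<in> u ` ({1..d} - {l})" using k l(3) by blast
        then have "u k \<in> H l" using H l1 hull_inc[of "u k" "u ` ({1..d} - {l})" convex] by blast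
        then show ?thesis using False by (simp add: B_def hull_inc)
      qed
      then show ?thesis using A_zero[of c] \<sigma>[OF l(1)] l(2) by simp
    qed
    have kD: "\<sigma> k \<in> D" using \<sigma>(1) k by simp
    let ?x = "f (u k)"
    have "(\<Sum>c\<in>D. n c \<bullet> ?x + b c) = n (\<sigma> k) \<bullet> ?x + b (\<sigma> k)"
      using zero by (subst sum.remove[OF finD kD]) simp
    then have 1: "n (\<sigma> k) \<bullet> ?x + b (\<sigma> k) = 1" using nb(2) by simp
    have "(\<Sum>c\<in>D. (n c \<bullet> ?x + b c) *\<^sub>R c) = (n (\<sigma> k) \<bullet> ?x + b (\<sigma> k)) *\<^sub>R \<sigma> k"
      using zero by (subst sum.remove[OF finD kD]) simp
    then show ?thesis using nb(3)[of ?x] 1 by simp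
  qed
  then have W\<sigma>: "W = \<sigma> ` {1..d}" unfolding W_def image_image by (intro image_cong) auto
  have "{0..d} = insert 0 {1..d}" by auto
  then have "D = insert (\<sigma> 0) W" using D\<sigma> W\<sigma> by simp
  \<comment> \<open>Besides \<open>W\<close>, the simplex has only the vertex
    \<open>\<sigma> 0\<close>; as \<open>a\<close> is a vertex outside \<open>W\<close>, it is that
    one.\<close>
  moreover have "a \<in> D"
    using a(1) extreme_point_of_convex_hull unfolding D(3) vertices_def by blast
  ultimately have DW: "D = insert a W" using a_W by blast
  \<comment> \<open>Being affine does not by itself make \<open>g\<close> invertible. Its range is
    an affine subspace containing all vertices of \<Sigma>, hence the whole space, so its linear
    part is surjective and therefore injective.\<close>
  have g_inj: "\<exists>L c. linear L \<and> inj L \<and> g = (\<lambda>x. L x + c)"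
  proof -
    obtain L c where L: "linear L" "g = (\<lambda>x. L x + c)" using g(1) by (auto simp: affine_map_def)
    have "D \<subseteq> range g"
      unfolding DW W_def image_image using g(2,3) by (metis (no_types, lifting) image_subsetI insert_subset rangeI)
    moreover have "range g = (\<lambda>x. c + x) ` range L" by (auto simp: L(2) add.commute)
    moreover have "affine ((\<lambda>x. c + x) ` range L)"
      using subspace_imp_affine[OF linear_subspace_image[OF L(1) subspace_UNIV]]
      by (simp only: affine_translation[symmetric])
    ultimately have "affine hull D \<subseteq> range g" by (simp add: hull_minimal)
    moreover have "affine hull D = UNIV" using affine_independent_span_eq D(1,2) by fastforce
    ultimately have "surj g" by blast
    then have "surj L"
      unfolding surj_def L(2) by (metis add_diff_cancel_right' diff_add_cancel)
    then have "inj L" using L(1) linear_surjective_imp_injective by blast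
    then show ?thesis using L by blast
  qed
  then obtain L c where L: "linear L" "inj L" "g = (\<lambda>x. L x + c)" by blast
  interpret pg: projective_map P2 g "\<lambda>z. (L (fst z) + snd z *\<^sub>R c, snd z)" "\<lambda>_. 1"
    unfolding L(3) by (rule affine_bij_imp_projective_map[OF L(1,2) P2(2)])
  have gW: "g ` neighbours P2 v = W"
    unfolding Vu'[symmetric] W_def image_image using g(3) by (intro image_cong) auto
  have vP: "v \<in> P2" using v vertices_subset by blast
  interpret mp: merge_position "f ` P1" "g ` P2" W a n b
  proof
    show "\<not> affine_dependent (insert a W)" using D(1) DW by simp
    show "a \<notin> W" "card W = DIM('a)" by (rule a_W cardW)+
    show "polytope (f ` P1)" "polytope (g ` P2)" using pf.polytope_image pg.polytope_image P1 P2 by blast+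
    show "f ` P1 \<subseteq> convex hull insert a W" using P1\<Sigma> D(3) DW by simp
    show "(convex hull W) facet_of f ` P1"
      unfolding hullW using pf.facet_of_image_iff[OF FP(1)] F by blast
    show "(f ` P1 \<inter> affine hull (insert a W - {w})) facet_of f ` P1" if "w \<in> W" for w
    proof -
      obtain k where k: "k \<in> {1..d}" "w = \<sigma> k" using \<open>w \<in> W\<close> W\<sigma> by blast
      have Hk: "H k facet_of P1" using H k by blast
      have fH: "f ` H k facet_of f ` P1"
        using pf.facet_of_image_iff[OF facet_of_imp_subset[OF Hk]] Hk by blast
      \<comment> \<open>The hyperplane opposite \<open>w\<close> is spanned by the image of
        \<open>H k\<close>, so the side facet is that image.\<close>
      have "affine hull (insert a W - {w}) = affine hull (f ` H k)"
        using \<sigma>(2)[of k] k DW by (simp add: A_def B_def)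
      then show ?thesis
        using face_eq_Int_affine_hull[OF pf.convex_image[OF order_refl P1(2)] facet_of_imp_face_of[OF fH]] fH
        by simp
    qed
    show "a \<in> vertices (g ` P2)" unfolding pg.vertices_image using v g(2) by blast
    show "neighbours (g ` P2) a = W" using pg.neighbours_image[OF vP] g(2) gW by simp
  qed (use nb DW in simp_all)
  have MM: "M = mp.M" using M g(2) mp.M_def by simp
  have "i < DIM('a)" using assms(2,4) dim by simp
  then show ?thesis
    using mp.j_simplicial_M[of j] mp.i_simple_M[of i] pf.j_simplicial_image pf.i_simple_image
      pg.j_simplicial_image pg.i_simple_image MM dim by blast
qed

end
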